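(* Let $T>0$ and let $\omega$ be any nonempty open subset of $(0,2\pi)$. For every $(u_0,v_0)\in (H^2_{per}(0,2\pi))^*\times (H^1_{per}(0,2\pi))^*$ with $\langle u_0,1\rangle_{(H^2_{per})^*,H^2_{per}}=0$, there exists a control $h\in L^2((0,T)\times(0,2\pi))$ of the form $h(t,x)=1_{\omega}(x)f(x)g(t)$ such that the solution $(u,v)$ of \[ \begin{cases} u_t+u_{xxxx}+u_{xxx}+u_{xx}-v_x=0, & (t,x)\in(0,T)\times(0,2\pi),\\ v_t-v_{xx}+v_x-u_x=h, & (t,x)\in(0,T)\times(0,2\pi),\\ \partial_x^j u(t,0)=\partial_x^j u(t,2\pi),\ j=0,1,2,3, & t\in(0,T),\\ \partial_x^j v(t,0)=\partial_x^j v(t,2\pi),\ j=0,1, & t\in(0,T),\\ u(0,\cdot)=u_0,\ v(0,\cdot)=v_0, \end{cases} \] satisfies $u(T,\cdot)=0$ and $v(T,\cdot)=0$.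
   Context: Functions are complex valued. For $s\ge 0$, $H^s_{per}(0,2\pi)$ is the space of $\phi=\sum_{k\in\mathbb Z}\phi_k e^{-ikx}\in L^2(0,2\pi)$ with $\sum_k(1+|k|^2)^s|\phi_k|^2<\infty$. $(H^s_{per})^*$ denotes its dual with respect to the pivot space $L^2(0,2\pi)$, and $\langle\cdot,\cdot\rangle_{(H^s_{per})^*,H^s_{per}}$ the duality pairing. The system is well posed with solution $(u,v)\in C([0,T];(H^2_{per})^*\times(H^1_{per})^* )$. $1_\omega$ is the indicator function of $\omega$. *)

theory Defs
  imports "HOL-Analysis.Analysis"
begin

text \<open>Periodic distributions on (0, 2 pi) are represented by their Fourier coefficients:
  phi = sum over k of phi_k e^{-ikx}, i.e. a map int => complex.\<close>

definition Hper_dual :: "real \<Rightarrow> (int \<Rightarrow> complex) \<Rightarrow> bool" where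
  "Hper_dual s \<phi> \<longleftrightarrow>
     (\<lambda>k. (1 + (real_of_int k)\<^sup>2) powr (- s) * (cmod (\<phi> k))\<^sup>2) summable_on (UNIV :: int set)"

text \<open>Duality pairing extending the L2(0,2 pi) inner product (pivot space).\<close>
definition dual_pairing :: "(int \<Rightarrow> complex) \<Rightarrow> (int \<Rightarrow> complex) \<Rightarrow> complex" where
  "dual_pairing \<phi> \<psi> = complex_of_real (2 * pi) * infsum (\<lambda>k. \<phi> k * cnj (\<psi> k)) UNIV"

definition one_fc :: "int \<Rightarrow> complex" where
  "one_fc k = (if k = 0 then 1 else 0)"

text \<open>Fourier coefficient of 1_omega f (convention phi_k = (1/2pi) int phi(x) e^{ikx} dx).\<close>
definition fourier_coeff_on :: "real set \<Rightarrow> (real \<Rightarrow> complex) \<Rightarrow> int \<Rightarrow> complex" where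
  "fourier_coeff_on \<omega> f k =
     (LINT x:\<omega>|lebesgue. f x * exp (\<i> * of_int k * of_real x)) / complex_of_real (2 * pi)"

definition L2_on :: "real set \<Rightarrow> (real \<Rightarrow> complex) \<Rightarrow> bool" where
  "L2_on S f \<longleftrightarrow> set_borel_measurable lebesgue S f \<and>
                   set_integrable lebesgue S (\<lambda>x. (cmod (f x))\<^sup>2)"

text \<open>Symbol of d/dx on the mode e^{-ikx}.\<close>
definition dx :: "int \<Rightarrow> complex" where
  "dx k = - \<i> * of_int k"

text \<open>(U, V) is the (weak) solution of the system on [0,T]: U k t, V k t are the
  k-th Fourier coefficients of u(t,.), v(t,.); hk is the k-th Fourier coefficient of h(t,.).
  Periodic boundary conditions are built into the Fourier representation.\<close>
definition is_solution ::
  "real \<Rightarrow> (int \<Rightarrow> complex) \<Rightarrow> (int \<Rightarrow> complex) \<Rightarrow> (int \<Rightarrow> real \<Rightarrow> complex)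
   \<Rightarrow> (int \<Rightarrow> real \<Rightarrow> complex) \<Rightarrow> (int \<Rightarrow> real \<Rightarrow> complex) \<Rightarrow> bool" where
  "is_solution T u0 v0 hk U V \<longleftrightarrow>
     (\<forall>k::int.
        continuous_on {0..T} (U k) \<and> continuous_on {0..T} (V k) \<and>
        (\<forall>t\<in>{0..T}.
          ((\<lambda>s. - ((dx k)^4 + (dx k)^3 + (dx k)^2) * U k s + dx k * V k s)
              has_integral (U k t - u0 k)) {0..t} \<and>
          ((\<lambda>s. ((dx k)^2 - dx k) * V k s + dx k * U k s + hk k s)
              has_integral (V k t - v0 k)) {0..t}))"

end

theory Submission
  imports Defs "HOL-Real_Asymp.Real_Asymp" "HOL-Library.Nat_Bijection"
begin

text \<open>Left eigenvectors of the symbol of the system turn null controllability by \<open>f(x) g(t)\<close> into a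
  moment problem for \<open>g\<close> with exponentials \<open>exp (- \<mu>\<^sub>j t)\<close>, where the \<open>\<mu>\<^sub>j\<close> are uniformly
  separated and \<open>Re \<mu>\<^sub>j\<close> grows at least quadratically. Taking \<open>f = exp\<close> on an interval inside
  \<open>\<omega>\<close> keeps the Fourier coefficients of the profile polynomially bounded from below.

  The function biorthogonal to \<open>exp (- \<mu>\<^sub>n t)\<close> is \<open>exp (\<mu>\<^sub>n t)\<close> times an infinite convolution
  product: each factor \<open>\<phi> \<mapsto> \<phi>(\<cdot> - d) - exp (- \<nu> d) \<phi>\<close> annihilates \<open>exp (- \<nu> t)\<close>, with
  \<open>\<nu> = \<mu>\<^sub>m - \<mu>\<^sub>n\<close>, and enlarges the support by only \<open>d\<close>. Tiny delays for the finitely many low modes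
  and delays of order \<open>m powr (-3/2)\<close> for the others keep the support arbitrarily short and the norm
  below \<open>K exp (\<epsilon> Re \<mu>\<^sub>n)\<close>, which the dissipation factor \<open>exp (- T Re \<mu>\<^sub>n)\<close> of the data absorbs.\<close>

section \<open>Infinite products of delay operators\<close>

text \<open>On the transform of \<open>\<phi>\<close> against \<open>exp (- z * t)\<close> each step
  acts as multiplication by \<open>exp (- z * d n) - q n\<close>, so a suitable \<open>q n\<close>
  plants a zero at a prescribed \<open>z\<close>. With \<open>d n = 0\<close> and
  \<open>q n = 0\<close> the step is the identity, which allows an index to be skipped.\<close>

fun delay_product :: "(nat \<Rightarrow> real) \<Rightarrow> (nat \<Rightarrow> complex) \<Rightarrow> (real \<Rightarrow> complex) \<Rightarrow> nat \<Rightarrow> real \<Rightarrow> complex" where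
  "delay_product d q \<phi> 0 t = \<phi> t"
| "delay_product d q \<phi> (Suc n) t =
     delay_product d q \<phi> n (t - d n) - q n * delay_product d q \<phi> n t"

lemma delay_product_support:
  assumes "\<And>i. 0 \<le> d i" "\<And>t. t \<notin> {0..\<eta>} \<Longrightarrow> \<phi> t = 0" "t \<notin> {0..\<eta> + (\<Sum>i<n. d i)}"
  shows "delay_product d q \<phi> n t = 0"
  using assms(3)
proof (induction n arbitrary: t)
  case 0
  then show ?case using assms(2) by simp
next
  case (Suc n)
  have "0 \<le> d n" by (rule assms)
  then have "t - d n \<notin> {0..\<eta> + (\<Sum>i<n. d i)}" "t \<notin> {0..\<eta> + (\<Sum>i<n. d i)}"
    using Suc.prems by auto
  then show ?case using Suc.IH by simp
qed

lemma continuous_on_delay_product: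
  assumes "continuous_on UNIV \<phi>"
  shows "continuous_on UNIV (delay_product d q \<phi> n)"
proof (induction n)
  case 0
  then show ?case using assms by (simp add: fun_eq_iff[symmetric] cong: continuous_on_cong)
next
  case (Suc n)
  have "continuous_on UNIV (\<lambda>t. delay_product d q \<phi> n (t - d n))"
    by (rule continuous_on_compose2[OF Suc]) (auto intro: continuous_intros)
  then have "continuous_on UNIV (\<lambda>t. delay_product d q \<phi> n (t - d n) - q n * delay_product d q \<phi> n t)"
    by (intro continuous_intros Suc)
  then show ?case by (simp cong: continuous_on_cong)
qed

lemma norm_delay_product_le:
  assumes "\<And>t. norm (\<phi> t) \<le> M"
  shows "norm (delay_product d q \<phi> n t) \<le> (\<Prod>i<n. 1 + norm (q i)) * M"
proof (induction n arbitrary: t)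
  case 0
  then show ?case using assms by simp
next
  case (Suc n)
  let ?B = "(\<Prod>i<n. 1 + norm (q i)) * M"
  have "norm (delay_product d q \<phi> (Suc n) t)
      \<le> norm (delay_product d q \<phi> n (t - d n)) + norm (q n) * norm (delay_product d q \<phi> n t)"
    by (simp add: norm_mult[symmetric] norm_triangle_ineq4)
  also have "\<dots> \<le> ?B + norm (q n) * ?B"
    by (intro add_mono mult_left_mono Suc) auto
  finally show ?case by (simp add: algebra_simps)
qed

text \<open>Controls the difference between a delayed copy and the original when the infinite
  product is shown to converge.\<close>

lemma delay_product_lipschitz:
  assumes "\<And>s t. norm (\<phi> s - \<phi> t) \<le> \<bar>s - t\<bar>"
  shows "norm (delay_product d q \<phi> n s - delay_product d q \<phi> n t)
           \<le> (\<Prod>i<n. 1 + norm (q i)) * \<bar>s - t\<bar>"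
proof (induction n arbitrary: s t)
  case 0
  then show ?case using assms by simp
next
  case (Suc n)
  let ?p = "delay_product d q \<phi> n" and ?B = "(\<Prod>i<n. 1 + norm (q i))"
  have "norm (delay_product d q \<phi> (Suc n) s - delay_product d q \<phi> (Suc n) t)
      = norm ((?p (s - d n) - ?p (t - d n)) - q n * (?p s - ?p t))"
    by (simp add: algebra_simps)
  also have "\<dots> \<le> norm (?p (s - d n) - ?p (t - d n)) + norm (q n) * norm (?p s - ?p t)"
    by (simp add: norm_mult[symmetric] norm_triangle_ineq4)
  also have "\<dots> \<le> ?B * \<bar>s - t\<bar> + norm (q n) * (?B * \<bar>s - t\<bar>)"
    using Suc[of "s - d n" "t - d n"] Suc[of s t] by (intro add_mono mult_left_mono) auto
  finally show ?case by (simp add: algebra_simps)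
qed

text \<open>A shift by \<open>d n\<close> multiplies the transform by
  \<open>exp (- z * d n)\<close>. The right end \<open>L\<close> only has to lie beyond the support,
  so the induction hypothesis applies at \<open>L - d n\<close> for the shifted term and at
  \<open>L\<close> for the other.\<close>

lemma has_integral_delay_product:
  assumes d: "\<And>i. 0 \<le> d i" and supp: "\<And>t. t \<notin> {0..\<eta>} \<Longrightarrow> \<phi> t = 0"
    and I: "((\<lambda>t. exp (- z * of_real t) * \<phi> t) has_integral I) {0..\<eta>}"
    and L: "\<eta> + (\<Sum>i<n. d i) \<le> L"
  shows "((\<lambda>t. exp (- z * of_real t) * delay_product d q \<phi> n t) has_integral
           (\<Prod>i<n. exp (- z * of_real (d i)) - q i) * I) {0..L}"
  using L
proof (induction n arbitrary: L)
  case 0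
  have "((\<lambda>t. exp (- z * of_real t) * \<phi> t) has_integral I) {0..L}"
    by (rule has_integral_on_superset[OF I]) (use 0 supp in auto)
  then show ?case by simp
next
  case (Suc n)
  let ?p = "delay_product d q \<phi> n" and ?P = "(\<Prod>i<n. exp (- z * of_real (d i)) - q i) * I"
  have dn: "0 \<le> d n" by (rule d)
  have L': "\<eta> + (\<Sum>i<n. d i) \<le> L - d n" and L'': "\<eta> + (\<Sum>i<n. d i) \<le> L"
    using Suc.prems dn by auto
  have "((\<lambda>t. exp (- z * of_real (t - d n)) * ?p (t - d n)) has_integral ?P) {0 + d n..(L - d n) + d n}"
    using has_integral_shift_real_ivl[OF Suc.IH[OF L'], of "- d n"] by simp
  then have "((\<lambda>t. exp (- z * of_real (t - d n)) * ?p (t - d n)) has_integral ?P) {d n..L}"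
    by simp
  then have "((\<lambda>t. exp (- z * of_real (t - d n)) * ?p (t - d n)) has_integral ?P) {0..L}"
  proof (rule has_integral_on_superset)
    fix t assume "t \<notin> {d n..L}"
    then have "?p (t - d n) = 0"
      using L' by (intro delay_product_support[OF d supp]) auto
    then show "exp (- z * of_real (t - d n)) * ?p (t - d n) = 0" by simp
  qed (use dn in auto)
  from has_integral_diff[OF has_integral_mult_right[OF this, of "exp (- z * of_real (d n))"]
      has_integral_mult_right[OF Suc.IH[OF L''], of "q n"]]
  have "((\<lambda>t. exp (- z * of_real (d n)) * (exp (- z * of_real (t - d n)) * ?p (t - d n))
       - q n * (exp (- z * of_real t) * ?p t)) has_integral
       exp (- z * of_real (d n)) * ?P - q n * ?P) {0..L}" .
  moreover have "exp (- z * of_real (d n)) * (exp (- z * of_real (t - d n)) * w) = exp (- z * of_real t) * w" for t w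
  proof -
    have "- z * of_real (d n) + - z * of_real (t - d n) = - z * of_real t"
      by (simp add: algebra_simps)
    then show ?thesis by (metis exp_add mult.assoc)
  qed
  ultimately have "((\<lambda>t. exp (- z * of_real t) * ?p (t - d n) - q n * (exp (- z * of_real t) * ?p t))
      has_integral exp (- z * of_real (d n)) * ?P - q n * ?P) {0..L}" by (simp only:)
  moreover have "exp (- z * of_real t) * ?p (t - d n) - q n * (exp (- z * of_real t) * ?p t)
      = exp (- z * of_real t) * delay_product d q \<phi> (Suc n) t" for t
    by (simp add: algebra_simps)
  moreover have "exp (- z * of_real (d n)) * ?P - q n * ?P
      = (\<Prod>i<Suc n. exp (- z * of_real (d i)) - q i) * I"
    by (simp add: algebra_simps)
  ultimately show ?case by (simp only:)
qed

text \<open>The M-test gives uniform convergence, which preserves continuity, support, bound and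
  transforms. The transform of the limit is described as a limit of finite products because two
  things are read off from it later: a lower bound at \<open>z = 0\<close> and its vanishing at
  prescribed points.\<close>

lemma delay_product_limit:
  fixes d :: "nat \<Rightarrow> real" and q :: "nat \<Rightarrow> complex"
  assumes d: "\<And>i. 0 \<le> d i" "summable d" and q: "summable (\<lambda>i. norm (q i))"
    and supp: "\<And>t. t \<notin> {0..\<eta>} \<Longrightarrow> \<phi> t = 0" and bnd: "\<And>t. norm (\<phi> t) \<le> M"
    and lip: "\<And>s t. norm (\<phi> s - \<phi> t) \<le> \<bar>s - t\<bar>"
    and B: "\<And>n. (\<Prod>i<n. 1 + norm (q i)) \<le> B"
    and L: "\<eta> + suminf d \<le> L"
  obtains H where "continuous_on UNIV H" "\<And>t. t \<notin> {0..L} \<Longrightarrow> H t = 0"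
    "\<And>t. norm (H t) \<le> B * M"
    "\<And>z I. ((\<lambda>t. exp (- z * of_real t) * \<phi> t) has_integral I) {0..\<eta>} \<Longrightarrow>
       \<exists>J. ((\<lambda>t. exp (- z * of_real t) * H t) has_integral J) {0..L} \<and>
           (\<lambda>n. (\<Prod>i<n. exp (- z * of_real (d i)) - q i) * I) \<longlonglongrightarrow> J"
proof -
  let ?p = "delay_product d q \<phi>"
  have M0: "0 \<le> M" using bnd[of 0] norm_ge_zero order_trans by blast
  have Lip: "norm (?p n s - ?p n t) \<le> B * \<bar>s - t\<bar>" for n s t
    by (rule order_trans[OF delay_product_lipschitz[OF lip]]) (intro mult_right_mono B, simp)
  have Bnd: "norm (?p n t) \<le> B * M" for n t
    by (rule order_trans[OF norm_delay_product_le[OF bnd]]) (intro mult_right_mono B M0)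
  have cont0: "continuous_on UNIV \<phi>"
  proof (rule continuous_onI)
    fix x e :: real assume "0 < e"
    then show "\<exists>d>0. \<forall>x'\<in>UNIV. dist x' x < d \<longrightarrow> dist (\<phi> x') (\<phi> x) \<le> e"
      by (intro exI[of _ e]) (auto simp: dist_norm intro!: order_trans[OF lip])
  qed
  \<comment> \<open>Increments of the sequence, so that the partial products become partial sums of
    a series: the shift costs \<open>B * d n\<close> by the Lipschitz bound, the multiple
    \<open>q n\<close> costs \<open>norm (q n) * (B * M)\<close>.\<close>
  define f where "f n t = ?p (Suc n) t - ?p n t" for n t
  have fb: "norm (f n t) \<le> B * d n + norm (q n) * (B * M)" for n t
  proof -
    have "norm (f n t) = norm ((?p n (t - d n) - ?p n t) - q n * ?p n t)"
      by (simp add: f_def algebra_simps)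
    also have "\<dots> \<le> norm (?p n (t - d n) - ?p n t) + norm (q n) * norm (?p n t)"
      by (simp add: norm_mult[symmetric] norm_triangle_ineq4)
    also have "\<dots> \<le> B * d n + norm (q n) * (B * M)"
      using Lip[of n "t - d n" t] d(1)[of n] Bnd by (intro add_mono mult_left_mono) auto
    finally show ?thesis .
  qed
  have sb: "summable (\<lambda>n. B * d n + norm (q n) * (B * M))"
    by (intro summable_add summable_mult summable_mult2 d q)
  obtain l where "uniform_limit UNIV (\<lambda>n t. \<Sum>i<n. f i t) l sequentially"
    using Weierstrass_m_test[of UNIV f, OF fb sb] by blast
  then have "uniform_limit UNIV (\<lambda>n t. \<phi> t + (\<Sum>i<n. f i t)) (\<lambda>t. \<phi> t + l t) sequentially"
    by (intro uniform_limit_add uniform_limit_const)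
  moreover have "\<phi> t + (\<Sum>i<n. f i t) = ?p n t" for n t
    using sum_lessThan_telescope[of "\<lambda>n. ?p n t" n] by (simp only: f_def) simp
  ultimately obtain H where H: "uniform_limit UNIV ?p H sequentially"
    by (simp only:)
  have lim: "(\<lambda>n. ?p n t) \<longlonglongrightarrow> H t" for t
    by (rule tendsto_uniform_limitI[OF H]) simp
  have sum_le: "\<eta> + (\<Sum>i<n. d i) \<le> L" for n
    using L sum_le_suminf[OF d(2), of "{..<n}"] d(1) by auto
  show thesis
  proof (rule that)
    show contH: "continuous_on UNIV H"
      by (rule uniform_limit_theorem[OF _ H])
        (auto intro!: always_eventually continuous_on_delay_product cont0)
    show "H t = 0" if "t \<notin> {0..L}" for t
    proof -
      have "?p n t = 0" for n
        by (rule delay_product_support[OF d(1) supp]) (use that sum_le[of n] in auto)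
      then show ?thesis using LIMSEQ_unique[OF lim[of t], of 0] by simp
    qed
    show "norm (H t) \<le> B * M" for t
      by (rule LIMSEQ_le_const2[OF tendsto_norm[OF lim]]) (use Bnd in auto)
    fix z I assume I: "((\<lambda>t. exp (- z * of_real t) * \<phi> t) has_integral I) {0..\<eta>}"
    \<comment> \<open>Products of uniform limits converge uniformly only for bounded limits, hence
      the restriction to the compact interval.\<close>
    have bc: "bounded ((\<lambda>t. exp (- z * complex_of_real t)) ` {0..L})"
      by (intro compact_imp_bounded compact_continuous_image continuous_intros) auto
    have bH: "bounded (H ` {0..L})"
      by (intro compact_imp_bounded compact_continuous_image continuous_on_subset[OF contH]) auto
    have "uniform_limit {0..L} (\<lambda>n t. exp (- z * of_real t) * ?p n t)
            (\<lambda>t. exp (- z * of_real t) * H t) sequentially"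
      by (rule bounded_bilinear.bounded_uniform_limit[OF bounded_bilinear_mult uniform_limit_const
            uniform_limit_on_subset[OF H subset_UNIV] bH bc])
    then obtain I' J where IJ: "\<And>n. ((\<lambda>t. exp (- z * of_real t) * ?p n t) has_integral I' n) {0..L}"
      "((\<lambda>t. exp (- z * of_real t) * H t) has_integral J) {0..L}" "I' \<longlonglongrightarrow> J"
      by (rule uniform_limit_integral)
        (auto intro!: continuous_intros continuous_on_subset[OF continuous_on_delay_product[OF cont0]])
    have "I' = (\<lambda>n. (\<Prod>i<n. exp (- z * of_real (d i)) - q i) * I)"
      by (rule ext) (rule has_integral_unique[OF IJ(1) has_integral_delay_product[OF d(1) supp I sum_le]])
    with IJ(2,3) show "\<exists>J. ((\<lambda>t. exp (- z * of_real t) * H t) has_integral J) {0..L} \<and>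
           (\<lambda>n. (\<Prod>i<n. exp (- z * of_real (d i)) - q i) * I) \<longlonglongrightarrow> J"
      by blast
  qed
qed

section \<open>Biorthogonal functions and the moment problem\<close>

lemma prod_one_plus_le_exp_sum:
  fixes x :: "'a \<Rightarrow> real"
  assumes "\<And>i. i \<in> A \<Longrightarrow> 0 \<le> x i"
  shows "(\<Prod>i\<in>A. 1 + x i) \<le> exp (\<Sum>i\<in>A. x i)"
proof (cases "finite A")
  case True
  have "(\<Prod>i\<in>A. 1 + x i) \<le> (\<Prod>i\<in>A. exp (x i))"
    using assms by (intro prod_mono) (auto intro: add_nonneg_nonneg)
  then show ?thesis using True by (simp add: exp_sum)
qed simp

text \<open>The Weierstrass product inequality; it keeps the tail of the infinite product away from
  0.\<close>

lemma one_minus_sum_le_prod: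
  fixes y :: "nat \<Rightarrow> real"
  assumes "\<And>i. 0 \<le> y i" "\<And>i. y i \<le> 1"
  shows "1 - (\<Sum>i<k. y i) \<le> (\<Prod>i<k. 1 - y i)"
proof (induction k)
  case (Suc k)
  have "0 \<le> (\<Sum>i<k. y i) * y k" by (intro mult_nonneg_nonneg sum_nonneg assms)
  then have "1 - (\<Sum>i<Suc k. y i) \<le> (1 - (\<Sum>i<k. y i)) * (1 - y k)"
    by (simp add: algebra_simps)
  also have "\<dots> \<le> (\<Prod>i<k. 1 - y i) * (1 - y k)"
    using assms by (intro mult_right_mono Suc) auto
  finally show ?case by simp
qed simp

lemma prod_lessThan_add_split:
  fixes f :: "nat \<Rightarrow> 'a::comm_monoid_mult"
  shows "(\<Prod>i<N + k. f i) = (\<Prod>i<N. f i) * (\<Prod>i<k. f (i + N))"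
  by (induction k) (simp_all add: add.commute mult.assoc)

text \<open>To first order \<open>1 - exp (- w)\<close> is \<open>w\<close>, and for
  \<open>norm w \<le> 1/4\<close> the quadratic remainder takes away at most half of it.\<close>

lemma norm_one_minus_exp_ge:
  fixes w :: complex
  assumes "norm w \<le> 1/4"
  shows "norm w / 2 \<le> norm (1 - exp (- w))"
proof -
  have "exp \<bar>Re w\<bar> \<le> exp (1/4)" using abs_Re_le_cmod[of w] assms by simp
  also have "\<dots> \<le> 2" using exp_bound_half[of "1/4 :: real"] by simp
  finally have e: "exp \<bar>Re w\<bar> \<le> 2" .
  have "norm (exp (- w) - (1 - w)) \<le> exp \<bar>Re w\<bar> * (norm w)\<^sup>2"
    using Taylor_exp[of "- w" 1] by (simp add: power2_eq_square)
  also have "\<dots> \<le> 2 * (norm w * (1/4))"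
    unfolding power2_eq_square using e assms by (intro mult_mono mult_left_mono) auto
  finally have "norm (exp (- w) - (1 - w)) \<le> norm w / 2" by simp
  moreover have "norm w \<le> norm (1 - exp (- w)) + norm (exp (- w) - (1 - w))"
    using norm_triangle_ineq[of "1 - exp (- w)" "exp (- w) - (1 - w)"] by simp
  ultimately show ?thesis by linarith
qed

text \<open>The tent of slope 1 over the interval. Its integral is the transform at
  \<open>z = 0\<close>; only its positivity matters.\<close>

lemma hat_function_exists:
  fixes \<eta> :: real
  assumes "0 < \<eta>"
  obtains \<phi> :: "real \<Rightarrow> complex" and I0 :: real where
    "\<And>t. t \<notin> {0..\<eta>} \<Longrightarrow> \<phi> t = 0" "\<And>t. norm (\<phi> t) \<le> \<eta>"
    "\<And>s t. norm (\<phi> s - \<phi> t) \<le> \<bar>s - t\<bar>" "continuous_on UNIV \<phi>"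
    "0 < I0" "(\<phi> has_integral of_real I0) {0..\<eta>}"
proof -
  define h :: "real \<Rightarrow> real" where "h t = max 0 (min t (\<eta> - t))" for t
  have cont: "continuous_on S h" for S unfolding h_def by (intro continuous_intros)
  have "integral {0..\<eta>} h \<noteq> 0"
  proof
    assume "integral {0..\<eta>} h = 0"
    moreover have "(integral {0..\<eta>} h = 0) = (\<forall>x\<in>{0..\<eta>}. h x = 0)"
      using assms by (intro integral_eq_0_iff cont) (auto simp: h_def)
    ultimately have "h (\<eta>/2) = 0" using assms by auto
    then show False using assms by (simp add: h_def)
  qed
  moreover have "0 \<le> integral {0..\<eta>} h"
    by (intro integral_nonneg integrable_continuous_interval cont) (auto simp: h_def)
  ultimately have pos: "0 < integral {0..\<eta>} h" by simp
  have int: "((\<lambda>t. complex_of_real (h t)) has_integral of_real (integral {0..\<eta>} h)) {0..\<eta>}"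
    by (intro has_integral_of_real integrable_integral integrable_continuous_interval cont)
  show thesis
  proof (rule that[OF _ _ _ _ pos int])
    show "norm (complex_of_real (h s) - complex_of_real (h t)) \<le> \<bar>s - t\<bar>" for s t
    proof -
      have "\<bar>h s - h t\<bar> \<le> \<bar>s - t\<bar>" unfolding h_def by linarith
      then show ?thesis by (simp flip: of_real_diff)
    qed
    show "norm (complex_of_real (h t)) \<le> \<eta>" for t
      using assms by (auto simp: h_def)
    show "continuous_on UNIV (\<lambda>t. complex_of_real (h t))"
      by (intro continuous_intros cont)
  qed (auto simp: h_def)
qed

text \<open>The delay product with \<open>q m = exp (- \<nu> m * d m)\<close> for
  \<open>m \<noteq> n\<close> annihilates all these exponentials; division by its integral
  normalises it. The integral is bounded below by treating two ranges differently: below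
  \<open>N\<close> the delays are so small that each factor is comparable to
  \<open>\<theta>\<close>, from \<open>N\<close> on \<open>norm (q m) \<le> E m\<close> is so small
  that the product stays above 1/2. The price is the power \<open>N\<close> in the bound.\<close>

lemma annihilator_exists:
  fixes \<nu> :: "nat \<Rightarrow> complex" and D E :: "nat \<Rightarrow> real" and \<phi> :: "real \<Rightarrow> complex"
  assumes \<phi>: "\<And>t. t \<notin> {0..\<tau>} \<Longrightarrow> \<phi> t = 0" "\<And>t. norm (\<phi> t) \<le> \<tau>"
    "\<And>s t. norm (\<phi> s - \<phi> t) \<le> \<bar>s - t\<bar>" "continuous_on UNIV \<phi>"
    "0 < I0" "(\<phi> has_integral of_real I0) {0..\<tau>}"
  assumes \<tau>: "0 < \<tau>" and \<gamma>: "0 < \<gamma>" and N: "1 \<le> N"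
    and gap: "\<And>m. m \<noteq> n \<Longrightarrow> \<gamma> \<le> norm (\<nu> m)"
    and D: "\<And>i. 0 \<le> D i" "summable D" "(\<Sum>i. D (i + N)) \<le> \<tau>"
    and E: "\<And>i. 0 \<le> E i" "summable E" "(\<Sum>i. E (i + N)) \<le> 1/2"
    and DE: "\<And>m. N \<le> m \<Longrightarrow> m \<noteq> n \<Longrightarrow> exp (- Re (\<nu> m) * D m) \<le> E m"
  obtains H where "continuous_on UNIV H" "\<And>t. t \<notin> {0..3 * \<tau>} \<Longrightarrow> H t = 0"
    "\<And>t. norm (H t) \<le> 4 * \<tau> / I0 * (6 / min (1/4) (\<tau> * \<gamma>) * N) ^ N"
    "(H has_integral 1) {0..3 * \<tau>}"
    "\<And>m. m \<noteq> n \<Longrightarrow> ((\<lambda>t. exp (- \<nu> m * of_real t) * H t) has_integral 0) {0..3 * \<tau>}"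
proof -
  \<comment> \<open>The division by \<open>N\<close> keeps the \<open>N\<close> head delays, each at
    most \<open>\<theta> / \<gamma>\<close>, below \<open>\<tau>\<close> in total; 1/4 is the range
    of the lower bound for \<open>1 - exp (- w)\<close>.\<close>
  define \<theta> where "\<theta> = min (1/4) (\<tau> * \<gamma>) / N"
  have \<theta>: "0 < \<theta>" using \<tau> \<gamma> N by (simp add: \<theta>_def)
  have "\<theta> \<le> min (1/4) (\<tau> * \<gamma>) / 1"
    unfolding \<theta>_def using N \<tau> \<gamma> by (intro divide_left_mono) auto
  then have \<theta>4: "\<theta> \<le> 1/4" by simp
  have "N * \<theta> \<le> \<tau> * \<gamma>" using N by (simp add: \<theta>_def)
  then have \<theta>N: "N * (\<theta> / \<gamma>) \<le> \<tau>" using \<gamma> by (simp add: field_simps)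
  \<comment> \<open>The head delay makes \<open>norm (\<nu> m * d m)\<close> exactly
    \<open>\<theta>\<close>. Index \<open>n\<close> is skipped, since its exponent must
    survive.\<close>
  define d where "d m = (if m = n then 0 else if m < N then \<theta> / norm (\<nu> m) else D m)" for m
  define q where "q m = (if m = n then 0 else exp (- \<nu> m * of_real (d m)))" for m
  have \<nu>0: "0 < norm (\<nu> m)" if "m \<noteq> n" for m using gap[OF that] \<gamma> by linarith
  have d0: "0 \<le> d m" for m using \<theta> D(1) by (simp add: d_def)
  have dtail: "d (i + N) \<le> D (i + N)" for i using D(1) by (simp add: d_def)
  have Dtail: "summable (\<lambda>i. D (i + N))" by (rule summable_ignore_initial_segment[OF D(2)])
  have dts: "summable (\<lambda>i. d (i + N))"
    by (rule summable_comparison_test'[OF Dtail, of 0]) (use d0 dtail in auto)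
  then have ds: "summable d" by (simp add: summable_iff_shift)
  have dhead: "d i \<le> \<theta> / \<gamma>" if "i < N" for i
    using that \<theta> \<gamma> gap[of i] by (auto simp: d_def intro!: frac_le)
  have "suminf d = (\<Sum>i. d (i + N)) + (\<Sum>i<N. d i)" by (rule suminf_split_initial_segment[OF ds])
  also have "(\<Sum>i. d (i + N)) \<le> \<tau>" using suminf_le[OF dtail dts Dtail] D(3) by linarith
  also have "(\<Sum>i<N. d i) \<le> (\<Sum>i<N. \<theta> / \<gamma>)" by (intro sum_mono dhead) auto
  \<comment> \<open>One \<open>\<tau>\<close> each for the support of \<open>\<phi>\<close>, the
    head delays and the tail delays.\<close>
  finally have dsum: "\<tau> + suminf d \<le> 3 * \<tau>" using \<theta>N by simp
  have qtail: "norm (q (i + N)) \<le> E (i + N)" for i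
  proof (cases "i + N = n")
    case False
    then have "norm (q (i + N)) = exp (- Re (\<nu> (i + N)) * D (i + N))"
      by (simp add: q_def d_def norm_exp_eq_Re)
    also have "\<dots> \<le> E (i + N)" using False by (intro DE) auto
    finally show ?thesis .
  qed (use E(1) in \<open>simp add: q_def\<close>)
  have Etail: "summable (\<lambda>i. E (i + N))" by (rule summable_ignore_initial_segment[OF E(2)])
  have qts: "summable (\<lambda>i. norm (q (i + N)))"
    by (rule summable_comparison_test'[OF Etail, of 0]) (use qtail in auto)
  then have qs: "summable (\<lambda>i. norm (q i))" using summable_iff_shift[of "\<lambda>i. norm (q i)" N] by simp
  have qsum: "(\<Sum>i<k. norm (q (i + N))) \<le> 1/2" for k
    using sum_le_suminf[OF qts, of "{..<k}"] suminf_le[OF qtail qts Etail] E(3) by simp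
  have qhead: "norm (q i) \<le> 2" and qlow: "\<theta> / 2 \<le> norm (1 - q i)" if "i < N" for i
  proof -
    have "norm (q i) \<le> 2 \<and> \<theta> / 2 \<le> norm (1 - q i)"
    proof (cases "i = n")
      case True
      then show ?thesis using \<theta>4 by (simp add: q_def)
    next
      case False
      define w where "w = \<nu> i * of_real (d i)"
      have w: "norm w = \<theta>" using False that \<nu>0[OF False] \<theta> by (simp add: w_def d_def norm_mult norm_divide)
      have qw: "q i = exp (- w)" using False by (simp add: q_def w_def)
      have "norm (q i) \<le> exp (1/2)"
        unfolding qw norm_exp_eq_Re using abs_Re_le_cmod[of w] w \<theta>4 by simp
      also have "\<dots> \<le> 2" using exp_bound_half[of "1/2 :: real"] by simp
      finally show ?thesis using norm_one_minus_exp_ge[of w] w \<theta>4 by (simp add: qw)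
    qed
    then show "norm (q i) \<le> 2" "\<theta> / 2 \<le> norm (1 - q i)" by auto
  qed
  \<comment> \<open>Each head factor is at most 1 + 2, and the whole tail contributes at most
    \<open>exp (1/2) \<le> 2\<close>.\<close>
  have B: "(\<Prod>i<k. 1 + norm (q i)) \<le> 3 ^ N * 2" for k
  proof -
    have "(\<Prod>i<k. 1 + norm (q i)) \<le> (\<Prod>i<N + k. 1 + norm (q i))"
      by (intro prod_mono2) (auto intro: add_nonneg_nonneg)
    also have "\<dots> = (\<Prod>i<N. 1 + norm (q i)) * (\<Prod>i<k. 1 + norm (q (i + N)))"
      by (rule prod_lessThan_add_split)
    also have "\<dots> \<le> (\<Prod>i<N. 3) * exp (1/2)"
    proof (intro mult_mono prod_mono)
      show "(\<Prod>i<k. 1 + norm (q (i + N))) \<le> exp (1/2)"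
        by (rule order_trans[OF prod_one_plus_le_exp_sum]) (use qsum in auto)
    qed (auto intro!: prod_nonneg add_nonneg_nonneg dest: qhead)
    also have "\<dots> \<le> 3 ^ N * 2" using exp_bound_half[of "1/2 :: real"] by simp
    finally show ?thesis .
  qed
  \<comment> \<open>The transform at \<open>z = 0\<close>, up to the factor \<open>I0\<close>: at
    least \<open>\<theta> / 2\<close> per head factor and at least 1/2 from the whole tail.\<close>
  have low: "(\<theta> / 2) ^ N / 2 \<le> norm (\<Prod>i<k + N. 1 - q i)" for k
  proof -
    have le1: "norm (q (i + N)) \<le> 1" for i
      using sum_le_suminf[OF Etail, of "{i}"] E qtail[of i] by simp
    have "(\<theta> / 2) ^ N * (1/2) \<le> (\<Prod>i<N. norm (1 - q i)) * (\<Prod>i<k. norm (1 - q (i + N)))"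
    proof (intro mult_mono)
      have "(\<Prod>i<N. \<theta> / 2) \<le> (\<Prod>i<N. norm (1 - q i))"
        using \<theta> qlow by (intro prod_mono) auto
      then show "(\<theta> / 2) ^ N \<le> (\<Prod>i<N. norm (1 - q i))" by simp
      have "1/2 \<le> 1 - (\<Sum>i<k. norm (q (i + N)))" using qsum[of k] by simp
      also have "\<dots> \<le> (\<Prod>i<k. 1 - norm (q (i + N)))"
        by (rule one_minus_sum_le_prod) (use le1 in auto)
      also have "\<dots> \<le> (\<Prod>i<k. norm (1 - q (i + N)))"
        by (intro prod_mono) (use le1 norm_triangle_ineq2[of "1::complex"] in \<open>auto simp: norm_one\<close>)
      finally show "1/2 \<le> (\<Prod>i<k. norm (1 - q (i + N)))" .
    qed (auto intro!: prod_nonneg)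
    also have "\<dots> = norm (\<Prod>i<k + N. 1 - q i)"
      by (simp add: add.commute[of k] prod_lessThan_add_split norm_mult prod_norm)
    finally show ?thesis by simp
  qed
  obtain H where H: "continuous_on UNIV H" "\<And>t. t \<notin> {0..3 * \<tau>} \<Longrightarrow> H t = 0"
    "\<And>t. norm (H t) \<le> 3 ^ N * 2 * \<tau>"
    and HI: "\<And>z I. ((\<lambda>t. exp (- z * of_real t) * \<phi> t) has_integral I) {0..\<tau>} \<Longrightarrow>
       \<exists>J. ((\<lambda>t. exp (- z * of_real t) * H t) has_integral J) {0..3 * \<tau>} \<and>
           (\<lambda>n. (\<Prod>i<n. exp (- z * of_real (d i)) - q i) * I) \<longlonglongrightarrow> J"
    by (rule delay_product_limit[OF d0 ds qs \<phi>(1,2,3) B dsum]) (assumption | blast)+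
  obtain J where J: "(H has_integral J) {0..3 * \<tau>}" "(\<lambda>n. (\<Prod>i<n. 1 - q i) * of_real I0) \<longlonglongrightarrow> J"
    using HI[of 0 "of_real I0"] \<phi>(6) by auto
  have "(\<theta> / 2) ^ N / 2 * I0 \<le> norm J"
  proof (rule LIMSEQ_le_const[OF tendsto_norm[OF LIMSEQ_ignore_initial_segment[OF J(2), of N]]])
    have "(\<theta> / 2) ^ N / 2 * I0 \<le> norm (\<Prod>i<k + N. 1 - q i) * I0" for k
      using low \<phi>(5) by (intro mult_right_mono) auto
    then show "\<exists>k0. \<forall>k\<ge>k0. (\<theta> / 2) ^ N / 2 * I0 \<le> norm ((\<Prod>i<k + N. 1 - q i) * of_real I0)"
      using \<phi>(5) by (simp add: norm_mult)
  qed
  moreover have "0 < (\<theta> / 2) ^ N / 2 * I0" using \<theta> \<phi>(5) by simp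
  ultimately have Jpos: "0 < norm J" and Jlow: "(\<theta> / 2) ^ N / 2 * I0 \<le> norm J" by linarith+
  show thesis
  proof (rule that[of "\<lambda>t. H t / J"])
    show "continuous_on UNIV (\<lambda>t. H t / J)" using H(1) Jpos by (intro continuous_intros) auto
    show "H t / J = 0" if "t \<notin> {0..3 * \<tau>}" for t using H(2)[OF that] by simp
    show "norm (H t / J) \<le> 4 * \<tau> / I0 * (6 / min (1/4) (\<tau> * \<gamma>) * N) ^ N" for t
    proof -
      have "norm (H t / J) \<le> (3 ^ N * 2 * \<tau>) / ((\<theta> / 2) ^ N / 2 * I0)"
        unfolding norm_divide using H(3) Jlow \<theta> \<phi>(5) \<tau> by (intro frac_le) auto
      also have "\<dots> = 4 * \<tau> / I0 * (3 ^ N / (\<theta> / 2) ^ N)" by (simp add: mult_ac)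
      also have "3 ^ N / (\<theta> / 2) ^ N = (6 / \<theta>) ^ N" by (simp flip: power_divide)
      also have "6 / \<theta> = 6 / min (1/4) (\<tau> * \<gamma>) * N" by (simp add: \<theta>_def)
      finally show ?thesis .
    qed
    show "((\<lambda>t. H t / J) has_integral 1) {0..3 * \<tau>}"
      using has_integral_divide[OF J(1), of J] Jpos by simp
    fix m assume m: "m \<noteq> n"
    have "(\<lambda>t. exp (- \<nu> m * of_real t) * \<phi> t) integrable_on {0..\<tau>}"
      by (intro integrable_continuous_interval continuous_intros continuous_on_subset[OF \<phi>(4)]) auto
    then obtain I J' where J': "((\<lambda>t. exp (- \<nu> m * of_real t) * H t) has_integral J') {0..3 * \<tau>}"
      and lim: "(\<lambda>k. (\<Prod>i<k. exp (- \<nu> m * of_real (d i)) - q i) * I) \<longlonglongrightarrow> J'"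
      using HI[of "\<nu> m"] by (meson integrable_on_def)
    \<comment> \<open>Once more than \<open>m\<close> factors are present, the one with index
      \<open>m\<close> is 0.\<close>
    have "(\<Prod>i<k + Suc m. exp (- \<nu> m * of_real (d i)) - q i) = 0" for k
      using m by (intro prod_zero bexI[of _ m]) (auto simp: q_def)
    then have "J' = 0"
      using LIMSEQ_unique[OF LIMSEQ_ignore_initial_segment[OF lim, of "Suc m"], of 0]
      by (simp only: mult_zero_left tendsto_const)
    then show "((\<lambda>t. exp (- \<nu> m * of_real t) * (H t / J)) has_integral 0) {0..3 * \<tau>}"
      using has_integral_divide[OF J', of J] by simp
  qed
qed

text \<open>Eventually \<open>A * N \<le> exp (c * N)\<close>, and the power \<open>N\<close> of
  this is the claim; \<open>K\<close> absorbs the finitely many exceptions. With \<open>N\<close> of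
  order \<open>sqrt (Re (\<mu> n))\<close> this makes the cost of an annihilator a small
  exponential.\<close>

lemma power_self_le_exp_square:
  fixes A c :: real
  assumes "0 < A" "0 < c"
  obtains K where "0 < K" "\<And>N::nat. (A * N) ^ N \<le> K * exp (c * (real N)\<^sup>2)"
proof -
  have "eventually (\<lambda>N::nat. A * N \<le> exp (c * N)) sequentially"
    using assms by real_asymp
  then obtain N0 where N0: "\<And>N. N0 \<le> N \<Longrightarrow> A * real N \<le> exp (c * N)"
    by (auto simp: eventually_sequentially)
  define K where "K = 1 + (\<Sum>N<N0. (A * real N) ^ N)"
  have nn: "0 \<le> (A * real N) ^ N" for N using assms by simp
  have K1: "1 \<le> K" unfolding K_def using sum_nonneg[of "{..<N0}", OF nn] by simp
  have "(A * N) ^ N \<le> K * exp (c * (real N)\<^sup>2)" for N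
  proof (cases "N0 \<le> N")
    case True
    have "(A * N) ^ N \<le> exp (c * N) ^ N" using N0[OF True] assms by (intro power_mono) auto
    also have "\<dots> = exp (c * (real N)\<^sup>2)"
      by (simp add: power2_eq_square mult_ac flip: exp_of_nat_mult)
    also have "\<dots> \<le> K * exp (c * (real N)\<^sup>2)" using K1 by simp
    finally show ?thesis .
  next
    case False
    have "(A * N) ^ N \<le> (\<Sum>N<N0. (A * real N) ^ N)"
      using False nn by (intro member_le_sum) auto
    then have "(A * N) ^ N \<le> K * 1" unfolding K_def by simp
    also have "\<dots> \<le> K * exp (c * (real N)\<^sup>2)"
      using K1 assms by (intro mult_left_mono) auto
    finally show ?thesis .
  qed
  then show thesis using that[of K] K1 by auto
qed

lemma summable_exp_minus_square:
  fixes b :: real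
  assumes "0 < b"
  shows "summable (\<lambda>n. exp (- (b * (real n)\<^sup>2)))"
proof (rule summable_comparison_test_bigo)
  show "summable (\<lambda>n. norm (real n powr (-2)))" by (simp add: summable_real_powr_iff)
  show "(\<lambda>n. exp (- (b * (real n)\<^sup>2))) \<in> O(\<lambda>n. real n powr (-2))"
    using assms by real_asymp
qed

text \<open>The annihilator for the differences \<open>\<mu> m - \<mu> n\<close> is multiplied by
  \<open>exp (\<mu> n * t)\<close>. Two costs arise, each at most
  \<open>exp (\<epsilon> * Re (\<mu> n) / 2)\<close> up to a constant: this multiplier on the short
  support, and the bound of the annihilator.\<close>

lemma biorthogonal_family:
  fixes \<mu> :: "nat \<Rightarrow> complex"
  assumes a: "0 < a" and \<gamma>: "0 < \<gamma>" and T: "0 < T" and \<epsilon>: "0 < \<epsilon>"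
    and growth: "\<And>n. a * (real n)\<^sup>2 \<le> Re (\<mu> n)"
    and gap: "\<And>m n. m \<noteq> n \<Longrightarrow> \<gamma> \<le> norm (\<mu> m - \<mu> n)"
  obtains K G where "\<And>n. continuous_on UNIV (G n)"
    "\<And>n t. norm (G n t) \<le> K * exp (\<epsilon> * Re (\<mu> n))"
    "\<And>m n. ((\<lambda>t. exp (- \<mu> m * of_real t) * G n t) has_integral (if m = n then 1 else 0)) {0..T}"
proof -
  \<comment> \<open>The support has length \<open>3 * \<tau>\<close>: it must fit into
    \<open>{0..T}\<close>, and the multiplier on it may grow by at most
    \<open>exp (\<epsilon> / 2 * Re (\<mu> n))\<close>.\<close>
  define \<tau> where "\<tau> = min T (\<epsilon> / 2) / 3"
  have \<tau>: "0 < \<tau>" "3 * \<tau> \<le> T" "3 * \<tau> \<le> \<epsilon> / 2" using T \<epsilon> by (auto simp: \<tau>_def)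
  obtain \<phi> :: "real \<Rightarrow> complex" and I0 where \<phi>: "\<And>t. t \<notin> {0..\<tau>} \<Longrightarrow> \<phi> t = 0" "\<And>t. norm (\<phi> t) \<le> \<tau>"
    "\<And>s t. norm (\<phi> s - \<phi> t) \<le> \<bar>s - t\<bar>" "continuous_on UNIV \<phi>"
    "0 < I0" "(\<phi> has_integral of_real I0) {0..\<tau>}"
    using hat_function_exists[OF \<tau>(1)] by blast
  \<comment> \<open>The exponent -3/2 makes the delays summable, while
    \<open>i\<^sup>2 * D i\<close> still grows like the square root of \<open>i\<close>, so that
    \<open>E\<close> is summable too.\<close>
  define D where "D i = (real i + 1) powr (-3/2)" for i :: nat
  define E where "E i = exp (- (a / 2 * (real i)\<^sup>2 * D i))" for i :: nat
  have pw: "summable (\<lambda>n. norm (real n powr (-3/2)))" by (simp add: summable_real_powr_iff)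
  have D: "0 \<le> D i" "summable D" for i
  proof -
    have "D \<in> O(\<lambda>n. real n powr (-3/2))" unfolding D_def by real_asymp
    then show "summable D" by (rule summable_comparison_test_bigo[OF pw])
  qed (simp add: D_def)
  have E: "0 \<le> E i" "summable E" for i
  proof -
    have "E \<in> O(\<lambda>n. real n powr (-3/2))" unfolding E_def D_def using a by real_asymp
    then show "summable E" by (rule summable_comparison_test_bigo[OF pw])
  qed (simp add: E_def)
  obtain N1 where N1: "\<And>N. N1 \<le> N \<Longrightarrow> norm (\<Sum>i. D (i + N)) < \<tau>"
    using suminf_exist_split[OF \<tau>(1) D(2)] by auto
  obtain N2 where N2: "\<And>N. N2 \<le> N \<Longrightarrow> norm (\<Sum>i. E (i + N)) < 1/2"
    using suminf_exist_split[OF _ E(2), of "1/2"] by auto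
  define A where "A = 6 / min (1/4) (\<tau> * \<gamma>)"
  have A: "0 < A" using \<tau> \<gamma> by (simp add: A_def)
  \<comment> \<open>Below, the square of \<open>N\<close> is at most
    \<open>2 * N3\<^sup>2 + 4 * R / a\<close>; this \<open>c\<close> turns the second term into
    \<open>\<epsilon> * R / 4\<close>.\<close>
  define c where "c = \<epsilon> * a / 16"
  have c: "0 < c" using \<epsilon> a by (simp add: c_def)
  obtain K1 where K1: "0 < K1" "\<And>N::nat. (A * N) ^ N \<le> K1 * exp (c * (real N)\<^sup>2)"
    using power_self_le_exp_square[OF A c] by blast
  \<comment> \<open>The 2 covers the 1 in the definition of \<open>N\<close> below and the rounding
    up of the square root.\<close>
  define N3 where "N3 = real (N1 + N2 + 2)"
  define K where "K = 4 * \<tau> / I0 * K1 * exp (2 * c * N3\<^sup>2)"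
  have "\<exists>G. continuous_on UNIV G \<and> (\<forall>t. norm (G t) \<le> K * exp (\<epsilon> * Re (\<mu> n))) \<and>
     (\<forall>m. ((\<lambda>t. exp (- \<mu> m * of_real t) * G t) has_integral (if m = n then 1 else 0)) {0..T})" for n
  proof -
    define R where "R = Re (\<mu> n)"
    have "0 \<le> a * (real n)\<^sup>2" using a by simp
    also have "\<dots> \<le> R" unfolding R_def by (rule growth)
    finally have R: "0 \<le> R" .
    \<comment> \<open>\<open>N1\<close> and \<open>N2\<close> make the tails of \<open>D\<close> and
      \<open>E\<close> small, and the 1 gives \<open>1 \<le> N\<close>. From
      \<open>sqrt (2 * R / a)\<close> on, \<open>R\<close> is at most half of
      \<open>a * m\<^sup>2\<close>, so \<open>Re (\<nu> m)\<close> keeps the other half.\<close>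
    define N where "N = N1 + N2 + 1 + nat \<lceil>sqrt (2 * R / a)\<rceil>"
    define \<nu> where "\<nu> m = \<mu> m - \<mu> n" for m
    have "real N \<le> N3 + sqrt (2 * R / a)"
      unfolding N_def N3_def using R a by (simp add: of_nat_nat) linarith
    then have "(real N)\<^sup>2 \<le> (N3 + sqrt (2 * R / a))\<^sup>2" by (intro power_mono) auto
    also have "\<dots> \<le> 2 * N3\<^sup>2 + 2 * (sqrt (2 * R / a))\<^sup>2"
      using zero_le_power2[of "N3 - sqrt (2 * R / a)"] unfolding power2_diff power2_sum by linarith
    also have "(sqrt (2 * R / a))\<^sup>2 = 2 * R / a" using R a by simp
    finally have "c * (real N)\<^sup>2 \<le> c * (2 * N3\<^sup>2 + 2 * (2 * R / a))"
      using c by (intro mult_left_mono) auto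
    also have "\<dots> = 2 * c * N3\<^sup>2 + \<epsilon> * R / 4" using a by (simp add: c_def field_simps)
    also have "\<dots> \<le> 2 * c * N3\<^sup>2 + \<epsilon> * R / 2" using \<epsilon> R by (simp add: mult_nonneg_nonneg)
    finally have cN: "c * (real N)\<^sup>2 \<le> 2 * c * N3\<^sup>2 + \<epsilon> * R / 2" .
    have DE: "exp (- Re (\<nu> m) * D m) \<le> E m" if "N \<le> m" for m
    proof -
      have "sqrt (2 * R / a) \<le> real m" using that unfolding N_def by linarith
      then have "(sqrt (2 * R / a))\<^sup>2 \<le> (real m)\<^sup>2" using R a by (intro power_mono) auto
      then have "2 * R \<le> a * (real m)\<^sup>2" using R a by (simp add: field_simps)
      then have "a / 2 * (real m)\<^sup>2 \<le> Re (\<nu> m)" using growth[of m] by (simp add: \<nu>_def R_def)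
      from mult_right_mono[OF this D(1)] show ?thesis by (simp add: E_def)
    qed
    obtain H where H: "continuous_on UNIV H" "\<And>t. t \<notin> {0..3 * \<tau>} \<Longrightarrow> H t = 0"
      "\<And>t. norm (H t) \<le> 4 * \<tau> / I0 * (A * N) ^ N"
      "(H has_integral 1) {0..3 * \<tau>}"
      "\<And>m. m \<noteq> n \<Longrightarrow> ((\<lambda>t. exp (- \<nu> m * of_real t) * H t) has_integral 0) {0..3 * \<tau>}"
      unfolding A_def
    proof (rule annihilator_exists[OF \<phi> \<tau>(1) \<gamma>])
      show "1 \<le> N" by (simp add: N_def)
      show "\<gamma> \<le> norm (\<nu> m)" if "m \<noteq> n" for m unfolding \<nu>_def by (rule gap[OF that])
      show "(\<Sum>i. D (i + N)) \<le> \<tau>" using N1[of N] by (simp add: N_def)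
      show "(\<Sum>i. E (i + N)) \<le> 1/2" using N2[of N] by (simp add: N_def)
    qed (use D E DE in auto)
    show ?thesis
    proof (intro exI[of _ "\<lambda>t. exp (\<mu> n * of_real t) * H t"] conjI allI)
      show "continuous_on UNIV (\<lambda>t. exp (\<mu> n * of_real t) * H t)"
        by (intro continuous_intros H)
      show "norm (exp (\<mu> n * of_real t) * H t) \<le> K * exp (\<epsilon> * Re (\<mu> n))" for t
      proof (cases "t \<in> {0..3 * \<tau>}")
        case True
        then have "R * t \<le> R * (\<epsilon> / 2)" using \<tau> R by (intro mult_left_mono) auto
        then have 1: "norm (exp (\<mu> n * of_real t)) \<le> exp (\<epsilon> * R / 2)"
          by (simp add: norm_exp_eq_Re R_def mult_ac)
        have "norm (H t) \<le> 4 * \<tau> / I0 * (K1 * exp (c * (real N)\<^sup>2))"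
          by (rule order_trans[OF H(3)]) (use K1(2)[of N] \<tau> \<phi>(5) in \<open>intro mult_left_mono, auto\<close>)
        also have "\<dots> \<le> 4 * \<tau> / I0 * (K1 * exp (2 * c * N3\<^sup>2 + \<epsilon> * R / 2))"
          using cN K1(1) \<tau> \<phi>(5) by (intro mult_left_mono) auto
        also have "\<dots> = K * exp (\<epsilon> * R / 2)" by (simp add: K_def exp_add)
        finally have "norm (exp (\<mu> n * of_real t)) * norm (H t) \<le> exp (\<epsilon> * R / 2) * (K * exp (\<epsilon> * R / 2))"
          using 1 by (intro mult_mono) auto
        also have "\<dots> = K * exp (\<epsilon> * R)" by (simp flip: exp_add)
        finally show ?thesis by (simp add: norm_mult R_def)
      next
        case False
        then show ?thesis using H(2) K1(1) \<tau> \<phi>(5) by (simp add: K_def)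
      qed
      fix m
      have "((\<lambda>t. exp (- \<nu> m * of_real t) * H t) has_integral (if m = n then 1 else 0)) {0..3 * \<tau>}"
        using H(4) H(5)[of m] by (cases "m = n") (auto simp: \<nu>_def)
      then have "((\<lambda>t. exp (- \<nu> m * of_real t) * H t) has_integral (if m = n then 1 else 0)) {0..T}"
        by (rule has_integral_on_superset) (use H(2) \<tau> in auto)
      moreover have "exp (- \<nu> m * of_real t) * H t = exp (- \<mu> m * of_real t) * (exp (\<mu> n * of_real t) * H t)" for t
        by (simp add: \<nu>_def algebra_simps flip: exp_add)
      ultimately show "((\<lambda>t. exp (- \<mu> m * of_real t) * (exp (\<mu> n * of_real t) * H t)) has_integral
          (if m = n then 1 else 0)) {0..T}" by (simp only:)
    qed
  qed
  then obtain G where "\<And>n. continuous_on UNIV (G n) \<and> (\<forall>t. norm (G n t) \<le> K * exp (\<epsilon> * Re (\<mu> n))) \<and>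
     (\<forall>m. ((\<lambda>t. exp (- \<mu> m * of_real t) * G n t) has_integral (if m = n then 1 else 0)) {0..T})"
    by metis
  then show thesis using that[of G K] by blast
qed

text \<open>The solution is the series of \<open>c n\<close> times the biorthogonal functions.
  Taking \<open>\<epsilon> = S / 2\<close> there spends half of the decay of \<open>c n\<close>; the
  other half, with the quadratic growth of \<open>Re (\<mu> n)\<close>, gives uniform
  convergence.\<close>

theorem exponential_moment_problem:
  fixes \<mu> c :: "nat \<Rightarrow> complex"
  assumes a: "0 < a" and \<gamma>: "0 < \<gamma>" and T: "0 < T" and S: "0 < S"
    and growth: "\<And>n. a * (real n)\<^sup>2 \<le> Re (\<mu> n)"
    and gap: "\<And>m n. m \<noteq> n \<Longrightarrow> \<gamma> \<le> norm (\<mu> m - \<mu> n)"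
    and c: "\<And>n. norm (c n) \<le> C * exp (- S * Re (\<mu> n))"
  obtains G where "continuous_on UNIV G"
    "\<And>n. ((\<lambda>t. exp (- \<mu> n * of_real t) * G t) has_integral c n) {0..T}"
proof -
  obtain G K where G: "\<And>n. continuous_on UNIV (G n)"
    "\<And>n t. norm (G n t) \<le> K * exp (S / 2 * Re (\<mu> n))"
    "\<And>m n. ((\<lambda>t. exp (- \<mu> m * of_real t) * G n t) has_integral (if m = n then 1 else 0)) {0..T}"
    by (rule biorthogonal_family[OF a \<gamma> T half_gt_zero[OF S] growth gap]) (assumption, rule that)
  have C0: "0 \<le> C" using order_trans[OF norm_ge_zero c[of 0]] by (simp add: zero_le_mult_iff)
  have K0: "0 \<le> K" using order_trans[OF norm_ge_zero G(2)[of 0]] by (simp add: zero_le_mult_iff)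
  have "norm (c n * G n t) \<le> C * K * exp (- (S * a / 2 * (real n)\<^sup>2))" for n t
  proof -
    have "norm (c n * G n t) \<le> (C * exp (- S * Re (\<mu> n))) * (K * exp (S / 2 * Re (\<mu> n)))"
      unfolding norm_mult using c G(2) C0 by (intro mult_mono) auto
    also have "\<dots> = C * K * exp (- (S / 2 * Re (\<mu> n)))"
      by (simp add: mult_ac flip: exp_add)
    also have "\<dots> \<le> C * K * exp (- (S / 2 * (a * (real n)\<^sup>2)))"
      using C0 K0 S growth[of n] by (intro mult_left_mono) auto
    finally show ?thesis by (simp add: mult_ac)
  qed
  moreover have "summable (\<lambda>n. C * K * exp (- (S * a / 2 * (real n)\<^sup>2)))"
    using S a by (intro summable_mult summable_exp_minus_square) auto
  ultimately have lim: "uniform_limit UNIV (\<lambda>n t. \<Sum>i<n. c i * G i t) (\<lambda>t. \<Sum>i. c i * G i t) sequentially"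
    (is "uniform_limit _ ?s ?G _") by (rule Weierstrass_m_test)
  have cs: "continuous_on X (?s n)" for n X
    using continuous_on_subset[OF G(1)] by (intro continuous_intros) auto
  have contG: "continuous_on UNIV ?G"
    by (rule uniform_limit_theorem[OF _ lim]) (auto intro!: always_eventually cs)
  show thesis
  proof (rule that[OF contG])
    fix m
    have bc: "bounded ((\<lambda>t. exp (- \<mu> m * complex_of_real t)) ` {0..T})"
      by (intro compact_imp_bounded compact_continuous_image continuous_intros) auto
    have bG: "bounded (?G ` {0..T})"
      by (intro compact_imp_bounded compact_continuous_image continuous_on_subset[OF contG]) auto
    have "uniform_limit {0..T} (\<lambda>n t. exp (- \<mu> m * of_real t) * ?s n t)
            (\<lambda>t. exp (- \<mu> m * of_real t) * ?G t) sequentially"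
      by (rule bounded_bilinear.bounded_uniform_limit[OF bounded_bilinear_mult uniform_limit_const
            uniform_limit_on_subset[OF lim subset_UNIV] bG bc])
    then obtain I J where IJ: "\<And>n. ((\<lambda>t. exp (- \<mu> m * of_real t) * ?s n t) has_integral I n) {0..T}"
      "((\<lambda>t. exp (- \<mu> m * of_real t) * ?G t) has_integral J) {0..T}" "I \<longlonglongrightarrow> J"
      by (rule uniform_limit_integral) (auto intro!: continuous_intros cs)
    \<comment> \<open>By biorthogonality the moments of the partial sums are already exact once the
      term \<open>m\<close> is included.\<close>
    have "I n = c m" if "Suc m \<le> n" for n
    proof -
      have "((\<lambda>t. \<Sum>i<n. c i * (exp (- \<mu> m * of_real t) * G i t)) has_integral
             (\<Sum>i<n. c i * (if m = i then 1 else 0))) {0..T}"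
        by (intro has_integral_sum has_integral_mult_right G) auto
      moreover have "(\<Sum>i<n. c i * (if m = i then 1 else 0)) = c m"
        using that by (simp add: if_distrib sum.delta cong: if_cong)
      moreover have "(\<Sum>i<n. c i * (exp (- \<mu> m * of_real t) * G i t)) = exp (- \<mu> m * of_real t) * ?s n t" for t
        by (simp add: sum_distrib_left mult_ac)
      ultimately show ?thesis using has_integral_unique[OF IJ(1)[of n]] by simp
    qed
    then have "I \<longlonglongrightarrow> c m"
      by (intro tendsto_eventually) (auto simp: eventually_sequentially)
    then have "J = c m" using IJ(3) LIMSEQ_unique by blast
    then show "((\<lambda>t. exp (- \<mu> m * of_real t) * ?G t) has_integral c m) {0..T}" using IJ(2) by simp
  qed
qed

section \<open>Eigenvalues of the symbol\<close>

text \<open>With \<open>sym_v\<close>, the multipliers on \<open>e^{-ikx}\<close> of the operators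
  \<open>D^4 + D^3 + D^2\<close> and \<open>- D^2 + D\<close>, where \<open>D\<close> is the
  derivative in \<open>x\<close>; with this sign positive real parts mean dissipation.\<close>

definition sym_u :: "int \<Rightarrow> complex" where
  "sym_u k = Complex (real_of_int k ^ 4 - (real_of_int k)\<^sup>2) (real_of_int k ^ 3)"

definition sym_v :: "int \<Rightarrow> complex" where
  "sym_v k = Complex ((real_of_int k)\<^sup>2) (- real_of_int k)"

text \<open>The two roots of the quadratic sum to \<open>s\<close> and have product
  \<open>p\<close>; \<open>e\<close> is the smaller one.\<close>

lemma quadratic_small_root:
  fixes s p :: complex
  obtains e where "e * (s - e) = p" "norm e \<le> norm (s - e)"
proof -
  define w where "w = csqrt (s\<^sup>2 - 4 * p)"
  have w: "w * w = s * s - 4 * p" by (metis power2_csqrt power2_eq_square w_def)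
  have 1: "((s - w) / 2) * (s - (s - w) / 2) = p" using w by (simp add: field_simps)
  have 2: "((s + w) / 2) * (s - (s + w) / 2) = p" using w by (simp add: field_simps)
  have 3: "s - (s - w) / 2 = (s + w) / 2" "s - (s + w) / 2 = (s - w) / 2" by (simp_all add: field_simps)
  show thesis
  proof (cases "norm ((s - w) / 2) \<le> norm ((s + w) / 2)")
    case True then show thesis using that[of "(s - w) / 2"] 1 3 by simp
  next
    case False then show thesis using that[of "(s + w) / 2"] 2 3 by simp
  qed
qed

text \<open>The eigenvalues are \<open>sym_u k - e\<close> and \<open>sym_v k + e\<close>. A
  bootstrap bounds \<open>e\<close>: as the smaller factor of a product of modulus
  \<open>x\<^sup>2\<close>, it is at most \<open>x\<close>; then \<open>s - e\<close> is at least
  \<open>5/2 * x\<^sup>2\<close> because the symbols are far apart, and dividing gives 2/5.\<close>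

lemma eigenvalue_correction:
  fixes k :: int
  assumes "2 \<le> \<bar>k\<bar>"
  obtains e where "e * (sym_u k - sym_v k - e) = (of_int k)\<^sup>2" "norm e \<le> 2/5"
proof -
  define x where "x = \<bar>real_of_int k\<bar>"
  have "\<bar>k\<bar> = 2 \<or> 3 \<le> \<bar>k\<bar>" using assms by linarith
  then have x: "x = 2 \<or> 3 \<le> x" unfolding x_def by linarith
  define s where "s = sym_u k - sym_v k"
  obtain e where e: "e * (s - e) = (of_int k)\<^sup>2" "norm e \<le> norm (s - e)"
    using quadratic_small_root by blast
  have ne: "norm e * norm (s - e) = x\<^sup>2"
    using arg_cong[OF e(1), of norm] by (simp add: norm_mult norm_power x_def)
  have "norm e * norm e \<le> norm e * norm (s - e)" using e(2) by (intro mult_left_mono) auto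
  then have "norm e \<le> x" unfolding ne power2_eq_square[symmetric] by (rule power2_le_imp_le) (simp add: x_def)
  have "(norm s)\<^sup>2 = (x * x * x * x - 2 * x * x)\<^sup>2 + (x * x * x + x)\<^sup>2"
  proof -
    have "(norm s)\<^sup>2 = (real_of_int k ^ 4 - 2 * (real_of_int k)\<^sup>2)\<^sup>2 + (real_of_int k ^ 3 + real_of_int k)\<^sup>2"
      unfolding cmod_power2 s_def sym_u_def sym_v_def by simp
    moreover have "real_of_int k = x \<or> real_of_int k = - x" unfolding x_def by linarith
    ultimately show ?thesis by (auto simp: algebra_simps power2_eq_square power3_eq_cube power4_eq_xxxx)
  qed
  also have "\<dots> = x\<^sup>2 * ((x * x * x - 2 * x)\<^sup>2 + (x * x + 1)\<^sup>2)" by (simp add: algebra_simps power2_eq_square)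
  also have "\<dots> \<ge> x\<^sup>2 * (1 + 5/2 * x)\<^sup>2"
  proof (intro mult_left_mono)
    \<comment> \<open>At \<open>x = 2\<close> both squares are needed, 41 against 36; from 3 on the
      first alone suffices.\<close>
    show "(1 + 5/2 * x)\<^sup>2 \<le> (x * x * x - 2 * x)\<^sup>2 + (x * x + 1)\<^sup>2"
      using x
    proof
      assume "3 \<le> x"
      then have "x * 9 \<le> x * (x * x)" using mult_mono[of 3 x 3 x] by (intro mult_left_mono) auto
      then have "1 + 5/2 * x \<le> x * x * x - 2 * x"
        using \<open>3 \<le> x\<close> unfolding mult.assoc by linarith
      then have "(1 + 5/2 * x)\<^sup>2 \<le> (x * x * x - 2 * x)\<^sup>2" using \<open>3 \<le> x\<close> by (intro power_mono) auto
      then show ?thesis by (simp add: add_increasing2)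
    qed (simp add: power2_eq_square)
  qed simp
  finally have "(x * (1 + 5/2 * x))\<^sup>2 \<le> (norm s)\<^sup>2" by (simp add: power_mult_distrib)
  then have "x * (1 + 5/2 * x) \<le> norm s" by (rule power2_le_imp_le) simp
  moreover have "norm s \<le> norm (s - e) + norm e" using norm_triangle_ineq[of "s - e" e] by simp
  ultimately have "5/2 * x\<^sup>2 \<le> norm (s - e)"
    using \<open>norm e \<le> x\<close> by (simp add: algebra_simps power2_eq_square)
  then have "norm e * (5/2 * x\<^sup>2) \<le> x\<^sup>2" unfolding ne[symmetric] by (intro mult_left_mono) auto
  then have "x\<^sup>2 * (norm e * (5/2)) \<le> x\<^sup>2 * 1" by (simp add: mult_ac)
  moreover have "0 < x\<^sup>2" using x by auto
  ultimately have "norm e * (5/2) \<le> 1" by (simp only: mult_le_cancel_left_pos)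
  then show thesis using that[of e] e(1) by (simp add: s_def)
qed

text \<open>The mode 1, too low for the perturbation argument, has symbols with sum 1 and
  discriminant \<open>- 7 - 4 * \<i>\<close>, hence eigenvalues \<open>(1 + r) / 2\<close> and
  \<open>(1 - r) / 2\<close>. The bounds on \<open>Re r\<close> keep their real parts between 1/8
  and 7/8; those on \<open>Im r\<close> separate mode 1 from mode -1.\<close>

lemma csqrt_minus_7_4i:
  fixes r :: complex
  defines "r \<equiv> csqrt (Complex (-7) (-4))"
  shows "r * r = Complex (-7) (-4)" "7/10 \<le> Re r" "Re r \<le> 3/4" "Im r \<le> -2" "- Im r \<le> 3"
proof -
  show rr: "r * r = Complex (-7) (-4)" unfolding r_def by (metis power2_csqrt power2_eq_square)
  define x y where "x = Re r" and "y = Im r"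
  have e: "x * x - y * y = -7" "2 * (x * y) = -4"
    using arg_cong[OF rr, of Re] arg_cong[OF rr, of Im] by (simp_all add: x_def y_def)
  have x0: "0 \<le> x" unfolding x_def r_def by (rule Re_csqrt)
  have "x * x * (y * y) = (x * y) * (x * y)" by (simp add: mult_ac)
  also have "\<dots> = 4" using e(2) by simp
  finally have q: "x * x * (x * x + 7) = 4" using e(1) by (simp add: algebra_simps)
  \<comment> \<open>The left side of \<open>q\<close> increases with \<open>x\<close>; it is about
    3.67 at 7/10 and 4.25 at 3/4.\<close>
  have "\<not> x < 7/10"
  proof
    assume "x < 7/10"
    then have "x * x \<le> 49/100" using x0 mult_mono[of x "7/10" x "7/10"] by simp
    then have "x * x * (x * x + 7) \<le> 49/100 * (49/100 + 7)" by (intro mult_mono) auto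
    then show False using q by simp
  qed
  moreover have "\<not> 3/4 < x"
  proof
    assume "3/4 < x"
    then have "9/16 \<le> x * x" using mult_mono[of "3/4" x "3/4" x] by simp
    then have "9/16 * (9/16 + 7) \<le> x * x * (x * x + 7)" by (intro mult_mono) auto
    then show False using q by simp
  qed
  ultimately have x: "7/10 \<le> x" "x \<le> 3/4" by auto
  have xy: "x * (- y) = 2" using e(2) by simp
  have y: "2 \<le> - y"
  proof (rule ccontr)
    assume "\<not> 2 \<le> - y"
    then have "x * (- y) \<le> x * 2" using x by (intro mult_left_mono) auto
    then show False using x xy by linarith
  qed
  have y': "- y \<le> 3"
  proof (rule ccontr)
    assume "\<not> - y \<le> 3"
    then have "x * 3 \<le> x * (- y)" using x by (intro mult_left_mono) auto
    then show False using x xy by linarith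
  qed
  show "7/10 \<le> Re r" "Re r \<le> 3/4" "Im r \<le> -2" "- Im r \<le> 3" using x y y' by (auto simp: x_def y_def)
qed

lemma norm_ge_if_Re_Im:
  fixes z :: complex
  assumes "c \<le> \<bar>Re z\<bar> \<or> c \<le> \<bar>Im z\<bar>"
  shows "c \<le> norm z"
  using assms abs_Re_le_cmod[of z] abs_Im_le_cmod[of z] by linarith

text \<open>The leading parts of the eigenvalues are pairwise distinct Gaussian integers, so perturbations
  of size at most 2/5 keep them separated. The value 2 at \<open>(0, False)\<close> is a dummy: the mode 0 only
  carries the eigenvalue 0.\<close>

lemma eigenvalues_exist:
  obtains M :: "int \<Rightarrow> bool \<Rightarrow> complex" where
    "\<And>k s. k \<noteq> 0 \<Longrightarrow> (M k s - sym_u k) * (M k s - sym_v k) = - ((of_int k)\<^sup>2)"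
    "M 0 True = 0" "M 0 False = 2"
    "\<And>k s. (real_of_int k)\<^sup>2 / 8 \<le> Re (M k s)"
    "\<And>k s. norm (M k s) \<le> 4 * (1 + (real_of_int k)\<^sup>2)\<^sup>2"
    "\<And>k s m r. (k, s) \<noteq> (m, r) \<Longrightarrow> 1/8 \<le> norm (M k s - M m r)"
proof -
  have "\<forall>k::int. \<exists>e. 2 \<le> \<bar>k\<bar> \<longrightarrow> e * (sym_u k - sym_v k - e) = (of_int k)\<^sup>2 \<and> norm e \<le> 2/5"
    using eigenvalue_correction by metis
  then obtain e where e: "\<And>k::int. 2 \<le> \<bar>k\<bar> \<Longrightarrow> e k * (sym_u k - sym_v k - e k) = (of_int k)\<^sup>2"
    "\<And>k::int. 2 \<le> \<bar>k\<bar> \<Longrightarrow> norm (e k) \<le> 2/5"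
    by metis
  define r where "r = csqrt (Complex (-7) (-4))"
  note r = csqrt_minus_7_4i[folded r_def]
  \<comment> \<open>Explicit eigenvalues of the modes 0, 1 and -1; those of -1 are the conjugates of
    those of 1.\<close>
  define S where "S k s = (if k = 0 then (if s then 0 else 2) else
      (1 + (if s then 1 else -1) * (if k = 1 then r else cnj r)) / 2)" for k :: int and s :: bool
  define Z where "Z k s = (if s then sym_u k else sym_v k)" for k s
  define M where "M k s = (if 2 \<le> \<bar>k\<bar> then (if s then sym_u k - e k else sym_v k + e k) else S k s)" for k s
  have small: "k \<in> {0, 1, -1}" if "\<not> 2 \<le> \<bar>k\<bar>" for k :: int using that by auto
  have MZ: "norm (M k s - Z k s) \<le> 2/5" if "2 \<le> \<bar>k\<bar>" for k s
    using e(2)[OF that] that by (simp add: M_def Z_def)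
  have Re_big: "(real_of_int k)\<^sup>2 - 2/5 \<le> Re (M k s)" "4 \<le> (real_of_int k)\<^sup>2" if "2 \<le> \<bar>k\<bar>" for k s
  proof -
    have "2 \<le> \<bar>real_of_int k\<bar>" using that by linarith
    then have k4: "4 \<le> (real_of_int k)\<^sup>2" using power_mono[of 2 "\<bar>real_of_int k\<bar>" 2] by simp
    have "(real_of_int k)\<^sup>2 * 4 \<le> (real_of_int k)\<^sup>2 * (real_of_int k)\<^sup>2" using k4 by (intro mult_left_mono) auto
    then have "(real_of_int k)\<^sup>2 \<le> Re (Z k s)"
      using k4 by (auto simp: Z_def sym_u_def sym_v_def power4_eq_xxxx power2_eq_square)
    moreover have "\<bar>Re (M k s - Z k s)\<bar> \<le> 2/5" using abs_Re_le_cmod MZ[OF that] order_trans by blast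
    ultimately show "(real_of_int k)\<^sup>2 - 2/5 \<le> Re (M k s)"
      unfolding minus_complex.sel by linarith
    show "4 \<le> (real_of_int k)\<^sup>2" by (rule k4)
  qed
  have Z_sep: "1 \<le> norm (Z k s - Z m q)" if "2 \<le> \<bar>k\<bar>" "2 \<le> \<bar>m\<bar>" "(k, s) \<noteq> (m, q)" for k s m q
  proof -
    define A where "A k s = (if s then k ^ 4 - k\<^sup>2 else k\<^sup>2)" for k :: int and s
    define B where "B k s = (if s then k ^ 3 else - k)" for k :: int and s
    have Z: "Z k s = Complex (of_int (A k s)) (of_int (B k s))" for k s
      by (simp add: Z_def A_def B_def sym_u_def sym_v_def)
    \<comment> \<open>Two values from different branches cannot meet: eliminating \<open>m\<close>
      leaves \<open>k ^ 4 = k\<^sup>2 - 1\<close>, which is impossible.\<close>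
    have cross: False if "2 \<le> \<bar>k\<bar>" "k ^ 4 - k\<^sup>2 = m\<^sup>2" "k ^ 3 = - m" for k m :: int
    proof -
      have "m\<^sup>2 = k ^ 3 * k ^ 3" using that(3) by (simp add: power2_eq_square)
      then have "k\<^sup>2 * (k\<^sup>2 * k\<^sup>2) = k\<^sup>2 * (k\<^sup>2 - 1)" using that(2)
        by (simp add: algebra_simps power2_eq_square power3_eq_cube power4_eq_xxxx)
      then have "k\<^sup>2 * k\<^sup>2 = k\<^sup>2 - 1" using that(1) by (subst (asm) mult_cancel_left) auto
      moreover have "k\<^sup>2 * 1 \<le> k\<^sup>2 * k\<^sup>2" using that(1) by (intro mult_left_mono) (auto simp: power2_eq_square int_one_le_iff_zero_less zero_less_mult_iff)
      ultimately show False by linarith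
    qed
    have cube: "k = m" if "k ^ 3 = m ^ 3" for k m :: int
    proof -
      have "\<bar>k\<bar> ^ 3 = \<bar>m\<bar> ^ 3" using that by (simp flip: power_abs)
      then have "\<bar>k\<bar> = \<bar>m\<bar>" by (rule power_eq_imp_eq_base) auto
      then show ?thesis using that by (auto simp: abs_eq_iff)
    qed
    have "A k s \<noteq> A m q \<or> B k s \<noteq> B m q"
    proof (rule ccontr)
      assume "\<not> (A k s \<noteq> A m q \<or> B k s \<noteq> B m q)"
      then have "A k s = A m q" "B k s = B m q" by auto
      then show False
        using that cross[of k m] cross[of m k] cube[of k m]
        by (cases s; cases q) (auto simp: A_def B_def)
    qed
    then have "1 \<le> \<bar>A k s - A m q\<bar> \<or> 1 \<le> \<bar>B k s - B m q\<bar>" by auto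
    then have "1 \<le> \<bar>real_of_int (A k s) - real_of_int (A m q)\<bar> \<or> 1 \<le> \<bar>real_of_int (B k s) - real_of_int (B m q)\<bar>"
      by linarith
    then show ?thesis by (intro norm_ge_if_Re_Im) (simp add: Z)
  qed
  have S0: "Re (S 0 s) = (if s then 0 else 2)" for s by (simp add: S_def)
  have S1: "1/8 \<le> Re (S k s)" "Re (S k s) \<le> 7/8" if "k \<noteq> 0" for k s
    using that r(2,3) by (simp_all add: S_def)
  \<comment> \<open>Mode 0 has the real parts 0 and 2, outside the range from 1/8 to 7/8 of the
    others. Among those, different branches differ by \<open>Re r\<close> in the real part, equal
    branches by \<open>Im r\<close> in the imaginary part.\<close>
  have S_sep: "1/8 \<le> norm (S k s - S m q)" if "k \<in> {0, 1, -1}" "m \<in> {0, 1, -1}" "(k, s) \<noteq> (m, q)" for k s m q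
  proof (rule norm_ge_if_Re_Im, unfold minus_complex.sel)
    consider "k = 0" "m = 0" | "k = 0" "m \<noteq> 0" | "k \<noteq> 0" "m = 0" | "k \<noteq> 0" "m \<noteq> 0" by blast
    then show "1/8 \<le> \<bar>Re (S k s) - Re (S m q)\<bar> \<or> 1/8 \<le> \<bar>Im (S k s) - Im (S m q)\<bar>"
    proof cases
      case 1
      then show ?thesis using that(3) by (cases s; cases q) (simp_all add: S0)
    next
      case 2
      then show ?thesis using S1[of m q] S0[of s] by (cases s) auto
    next
      case 3
      then show ?thesis using S1[of k s] S0[of q] by (cases q) auto
    next
      case 4
      show ?thesis
      proof (cases "s = q")
        case True
        then have "k = 1 \<and> m = -1 \<or> k = -1 \<and> m = 1" using 4 that by auto
        then have "\<bar>Im (S k s) - Im (S m q)\<bar> = \<bar>Im r\<bar>"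
          using True by (cases q) (auto simp: S_def)
        then show ?thesis using r(4) by linarith
      next
        case False
        moreover have "Re (S j b) = (if b then (1 + Re r) / 2 else (1 - Re r) / 2)" if "j \<noteq> 0" for j b
          using that by (simp add: S_def)
        ultimately have "Re (S k s) - Re (S m q) = Re r \<or> Re (S k s) - Re (S m q) = - Re r"
          using 4 by (cases s; cases q) (simp_all add: diff_divide_distrib[symmetric])
        then show ?thesis using r(2) by linarith
      qed
    qed
  qed
  have S_Re: "(real_of_int k)\<^sup>2 / 8 \<le> Re (S k s)" "Re (S k s) \<le> 2" "\<bar>Im (S k s)\<bar> \<le> 2" if "k \<in> {0, 1, -1}" for k s
  proof -
    show "(real_of_int k)\<^sup>2 / 8 \<le> Re (S k s)" "Re (S k s) \<le> 2"
      using that S1[of k s] S0[of s] by auto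
    show "\<bar>Im (S k s)\<bar> \<le> 2" using r(4,5) by (simp add: S_def)
  qed
  show thesis
  proof (rule that[of M])
    show "M 0 True = 0" "M 0 False = 2" by (simp_all add: M_def S_def)
    show "(M k s - sym_u k) * (M k s - sym_v k) = - ((of_int k)\<^sup>2)" if "k \<noteq> 0" for k s
    proof (cases "2 \<le> \<bar>k\<bar>")
      case True
      then show ?thesis using e(1)[OF True] by (cases s) (simp_all add: M_def algebra_simps)
    next
      case False
      have cc: "cnj r * cnj r = Complex (-7) 4"
        using arg_cong[OF r(1), of cnj] by (simp add: complex_eq_iff)
      have "k = 1 \<or> k = -1" using False that by auto
      then show ?thesis
      proof
        assume k: "k = 1"
        then show ?thesis using r(1)
          by (cases s) (simp_all add: M_def S_def sym_u_def sym_v_def complex_eq_iff field_simps)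
      next
        assume k: "k = -1"
        then show ?thesis using cc r(1)
          by (cases s) (simp_all add: M_def S_def sym_u_def sym_v_def complex_eq_iff field_simps)
      qed
    qed
    show "(real_of_int k)\<^sup>2 / 8 \<le> Re (M k s)" for k s
    proof (cases "2 \<le> \<bar>k\<bar>")
      case True
      then show ?thesis using Re_big(1)[OF True, of s] Re_big(2)[OF True] by linarith
    next
      case False
      then show ?thesis using S_Re(1)[OF small[OF False]] by (simp add: M_def)
    qed
    show "norm (M k s) \<le> 4 * (1 + (real_of_int k)\<^sup>2)\<^sup>2" for k s
    proof (cases "2 \<le> \<bar>k\<bar>")
      case True
      define x where "x = \<bar>real_of_int k\<bar>"
      have x: "2 \<le> x" using True unfolding x_def by linarith
      have x3: "x ^ 3 \<le> x ^ 4" using x by (intro power_increasing) auto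
      have x1: "x \<le> x\<^sup>2" using x by (simp add: power2_eq_square)
      have eq: "x\<^sup>2 = (real_of_int k)\<^sup>2" "x ^ 4 = real_of_int k ^ 4" "x ^ 3 = \<bar>real_of_int k ^ 3\<bar>"
        by (simp_all add: x_def power_abs power_even_abs)
      have "norm (Z k s) \<le> \<bar>Re (Z k s)\<bar> + \<bar>Im (Z k s)\<bar>" by (rule cmod_le)
      also have "\<dots> \<le> 2 * (x ^ 4 + x\<^sup>2)"
      proof -
        have "0 \<le> x ^ 4" "0 \<le> x\<^sup>2" by simp_all
        then have "\<bar>x ^ 4 - x\<^sup>2\<bar> \<le> x ^ 4 + x\<^sup>2" by linarith
        then show ?thesis
          using x1 x3 \<open>0 \<le> x ^ 4\<close> by (cases s) (simp_all add: Z_def sym_u_def sym_v_def x_def[symmetric] flip: eq)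
      qed
      finally have "norm (Z k s) \<le> 2 * (x ^ 4 + x\<^sup>2)" .
      moreover have "norm (M k s) \<le> norm (Z k s) + norm (M k s - Z k s)"
        using norm_triangle_ineq[of "Z k s" "M k s - Z k s"] by simp
      ultimately have "norm (M k s) \<le> 2 * (x ^ 4 + x\<^sup>2) + 2/5" using MZ[OF True, of s] by linarith
      also have "\<dots> \<le> 4 * (1 + 2 * x\<^sup>2 + x ^ 4)" by simp
      also have "\<dots> = 4 * (1 + x\<^sup>2)\<^sup>2" by (simp add: power2_eq_square power4_eq_xxxx algebra_simps)
      finally show ?thesis by (simp add: eq)
    next
      case False
      have "norm (M k s) \<le> \<bar>Re (M k s)\<bar> + \<bar>Im (M k s)\<bar>" by (rule cmod_le)
      also have "\<dots> \<le> 4 * 1\<^sup>2"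
      proof -
        have "0 \<le> Re (S k s)"
          using S_Re(1)[OF small[OF False], of s] zero_le_power2[of "real_of_int k"] by linarith
        then show ?thesis using S_Re(2,3)[OF small[OF False], of s] False by (simp add: M_def)
      qed
      also have "\<dots> \<le> 4 * (1 + (real_of_int k)\<^sup>2)\<^sup>2" by (intro mult_left_mono power_mono) auto
      finally show ?thesis .
    qed
    show "1/8 \<le> norm (M k s - M m q)" if ne: "(k, s) \<noteq> (m, q)" for k s m q
    proof (cases "2 \<le> \<bar>k\<bar>"; cases "2 \<le> \<bar>m\<bar>")
      assume k: "2 \<le> \<bar>k\<bar>" and m: "2 \<le> \<bar>m\<bar>"
      \<comment> \<open>Two perturbations of size 2/5 leave 1/5 of the distance 1. In the mixed
        cases below, real parts of at least 4 - 2/5 face real parts of at most 2.\<close>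
      have "Z k s - Z m q = (M k s - M m q) - (M k s - Z k s) + (M m q - Z m q)" by simp
      also have "norm \<dots> \<le> norm (M k s - M m q) + norm (M k s - Z k s) + norm (M m q - Z m q)"
        by (intro norm_triangle_le add_mono norm_triangle_ineq4) auto
      finally show ?thesis using Z_sep[OF k m ne] MZ[OF k, of s] MZ[OF m, of q] by linarith
    next
      assume k: "2 \<le> \<bar>k\<bar>" and m: "\<not> 2 \<le> \<bar>m\<bar>"
      have "Re (M m q) \<le> 2" using S_Re(2)[OF small[OF m]] m by (simp add: M_def)
      then show ?thesis using Re_big(1)[OF k, of s] Re_big(2)[OF k] by (intro norm_ge_if_Re_Im) auto
    next
      assume k: "\<not> 2 \<le> \<bar>k\<bar>" and m: "2 \<le> \<bar>m\<bar>"
      have "Re (M k s) \<le> 2" using S_Re(2)[OF small[OF k]] k by (simp add: M_def)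
      then show ?thesis using Re_big(1)[OF m, of q] Re_big(2)[OF m] by (intro norm_ge_if_Re_Im) auto
    next
      assume k: "\<not> 2 \<le> \<bar>k\<bar>" and m: "\<not> 2 \<le> \<bar>m\<bar>"
      then show ?thesis using S_sep[OF small[OF k] small[OF m] ne] by (simp add: M_def)
    qed
  qed
qed

section \<open>Mode-wise evolution and the control profile\<close>

lemma has_vector_derivative_exp_of_real:
  fixes z :: complex
  shows "((\<lambda>t. exp (z * of_real t)) has_vector_derivative z * exp (z * of_real t)) (at t within S)"
proof -
  have "((\<lambda>w. exp (z * w)) has_field_derivative z * exp (z * of_real t)) (at (of_real t))"
    by (auto intro!: derivative_eq_intros)
  then show ?thesis by (rule has_vector_derivative_real_field)
qed

text \<open>Duhamel's formula by the integrating factor \<open>exp (\<mu> * t)\<close>; continuity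
  of the integrand makes the integral equation differentiable. It holds for every solution, so no
  separate uniqueness result is required.\<close>

lemma linear_ode_terminal_value:
  fixes y h :: "real \<Rightarrow> complex"
  assumes T: "0 \<le> T" and y: "continuous_on {0..T} y" and h: "continuous_on {0..T} h"
    and eq: "\<And>t. t \<in> {0..T} \<Longrightarrow> ((\<lambda>s. - \<mu> * y s + h s) has_integral (y t - y0)) {0..t}"
    and J: "((\<lambda>s. exp (\<mu> * of_real s) * h s) has_integral J) {0..T}"
  shows "y T = exp (- \<mu> * of_real T) * (y0 + J)"
proof -
  define F where "F s = - \<mu> * y s + h s" for s
  have cF: "continuous_on {0..T} F" unfolding F_def by (intro continuous_intros y h)
  have yF: "y t = y0 + integral {0..t} F" if "t \<in> {0..T}" for t
    using integral_unique[OF eq[OF that]] by (simp add: F_def[abs_def])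
  have dy: "(y has_vector_derivative F t) (at t within {0..T})" if t: "t \<in> {0..T}" for t
  proof -
    have "((\<lambda>t. y0 + integral {0..t} F) has_vector_derivative 0 + F t) (at t within {0..T})"
      by (intro derivative_intros integral_has_vector_derivative cF t)
    then have "((\<lambda>t. y0 + integral {0..t} F) has_vector_derivative F t) (at t within {0..T})" by simp
    then show ?thesis by (rule has_vector_derivative_transform[OF t, rotated]) (rule yF)
  qed
  have "((\<lambda>t. exp (\<mu> * of_real t) * h t) has_integral
      (exp (\<mu> * of_real T) * y T - exp (\<mu> * of_real 0) * y 0)) {0..T}"
  proof (rule fundamental_theorem_of_calculus[OF T])
    fix t assume t: "t \<in> {0..T}"
    have "((\<lambda>t. exp (\<mu> * of_real t) * y t) has_vector_derivative
        exp (\<mu> * of_real t) * F t + \<mu> * exp (\<mu> * of_real t) * y t) (at t within {0..T})"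
      by (rule has_vector_derivative_mult[OF has_vector_derivative_exp_of_real dy[OF t]])
    then show "((\<lambda>t. exp (\<mu> * of_real t) * y t) has_vector_derivative exp (\<mu> * of_real t) * h t) (at t within {0..T})"
      by (simp add: F_def algebra_simps)
  qed
  then have "J = exp (\<mu> * of_real T) * y T - y 0" using has_integral_unique[OF J] by simp
  moreover have "y 0 = y0" using yF[of 0] T by simp
  ultimately show ?thesis by (simp add: exp_minus field_simps)
qed

lemma linear_ode_solution_exists:
  fixes h :: "real \<Rightarrow> complex"
  assumes h: "continuous_on {0..T} h"
  obtains y where "y 0 = y0"
    "\<And>t. t \<in> {0..T} \<Longrightarrow> (y has_vector_derivative (- \<mu> * y t + h t)) (at t within {0..T})"
proof -
  define F where "F s = exp (\<mu> * of_real s) * h s" for s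
  define y where "y t = exp (- \<mu> * of_real t) * (y0 + integral {0..t} F)" for t
  have cF: "continuous_on {0..T} F" unfolding F_def by (intro continuous_intros h)
  show thesis
  proof (rule that[of y])
    show "y 0 = y0" by (simp add: y_def)
    fix t assume t: "t \<in> {0..T}"
    have "((\<lambda>t. y0 + integral {0..t} F) has_vector_derivative 0 + F t) (at t within {0..T})"
      by (intro derivative_intros integral_has_vector_derivative cF t)
    from has_vector_derivative_mult[OF has_vector_derivative_exp_of_real[of "- \<mu>"] this]
    have "(y has_vector_derivative exp (- \<mu> * of_real t) * (0 + F t)
        + - \<mu> * exp (- \<mu> * of_real t) * (y0 + integral {0..t} F)) (at t within {0..T})"
      by (simp only: y_def[abs_def])
    moreover have "exp (- \<mu> * of_real t) * (0 + F t) = h t" by (simp add: F_def exp_minus)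
    ultimately show "(y has_vector_derivative (- \<mu> * y t + h t)) (at t within {0..T})"
      by (simp add: y_def algebra_simps)
  qed
qed

text \<open>The combination \<open>(\<beta> - \<mu>) U + d V\<close> is a left eigenvector of the system, which decouples it.\<close>

lemma linear_system_terminal_value:
  fixes U V h :: "real \<Rightarrow> complex"
  assumes T: "0 \<le> T" and U: "continuous_on {0..T} U" and V: "continuous_on {0..T} V"
    and h: "continuous_on {0..T} h" and char: "(\<mu> - \<alpha>) * (\<mu> - \<beta>) = d\<^sup>2"
    and eU: "\<And>t. t \<in> {0..T} \<Longrightarrow> ((\<lambda>s. - \<alpha> * U s + d * V s) has_integral (U t - u0)) {0..t}"
    and eV: "\<And>t. t \<in> {0..T} \<Longrightarrow> ((\<lambda>s. - \<beta> * V s + d * U s + h s) has_integral (V t - v0)) {0..t}"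
    and J: "((\<lambda>s. exp (\<mu> * of_real s) * h s) has_integral J) {0..T}"
  shows "(\<beta> - \<mu>) * U T + d * V T = exp (- \<mu> * of_real T) * (((\<beta> - \<mu>) * u0 + d * v0) + d * J)"
proof (rule linear_ode_terminal_value[OF T])
  show "continuous_on {0..T} (\<lambda>t. (\<beta> - \<mu>) * U t + d * V t)" by (intro continuous_intros U V)
  show "continuous_on {0..T} (\<lambda>t. d * h t)" by (intro continuous_intros h)
  show "((\<lambda>s. exp (\<mu> * of_real s) * (d * h s)) has_integral d * J) {0..T}"
    using has_integral_mult_right[OF J, of d] by (simp add: mult_ac)
  fix t assume t: "t \<in> {0..T}"
  have "((\<lambda>s. (\<beta> - \<mu>) * (- \<alpha> * U s + d * V s) + d * (- \<beta> * V s + d * U s + h s)) has_integral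
      ((\<beta> - \<mu>) * (U t - u0) + d * (V t - v0))) {0..t}"
    by (intro has_integral_add has_integral_mult_right eU eV t)
  moreover have "(\<beta> - \<mu>) * (- \<alpha> * x + d * z) + d * (- \<beta> * z + d * x + w)
      = - \<mu> * ((\<beta> - \<mu>) * x + d * z) + d * w" for x z w
  proof -
    have "d * d = (\<mu> - \<alpha>) * (\<mu> - \<beta>)" using char by (simp add: power2_eq_square)
    then have "d * (d * x) = (\<mu> - \<alpha>) * (\<mu> - \<beta>) * x" by (metis mult.assoc)
    then show ?thesis by (simp add: algebra_simps)
  qed
  moreover have "(\<beta> - \<mu>) * (U t - u0) + d * (V t - v0)
      = (\<beta> - \<mu>) * U t + d * V t - ((\<beta> - \<mu>) * u0 + d * v0)"
    by (simp add: algebra_simps)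
  ultimately show "((\<lambda>s. - \<mu> * ((\<beta> - \<mu>) * U s + d * V s) + d * h s) has_integral
      ((\<beta> - \<mu>) * U t + d * V t - ((\<beta> - \<mu>) * u0 + d * v0))) {0..t}"
    by (simp only:)
qed

text \<open>In the coordinates given by the two left eigenvectors the system splits into two scalar
  equations. Distinct eigenvalues and \<open>d \<noteq> 0\<close> make the change of coordinates
  invertible.\<close>

lemma linear_system_solution_exists:
  fixes h :: "real \<Rightarrow> complex"
  assumes h: "continuous_on {0..T} h" and d: "d \<noteq> 0" and ne: "\<mu>1 \<noteq> \<mu>2"
    and char: "(\<mu>1 - \<alpha>) * (\<mu>1 - \<beta>) = d\<^sup>2" "(\<mu>2 - \<alpha>) * (\<mu>2 - \<beta>) = d\<^sup>2"
  obtains U V where "continuous_on {0..T} U" "continuous_on {0..T} V"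
    "\<And>t. t \<in> {0..T} \<Longrightarrow> ((\<lambda>s. - \<alpha> * U s + d * V s) has_integral (U t - u0)) {0..t}"
    "\<And>t. t \<in> {0..T} \<Longrightarrow> ((\<lambda>s. - \<beta> * V s + d * U s + h s) has_integral (V t - v0)) {0..t}"
proof -
  have dd: "d * d = (\<mu>1 - \<alpha>) * (\<mu>1 - \<beta>)" using char(1) by (simp add: power2_eq_square)
  \<comment> \<open>Subtracting the characteristic equations yields Vieta's formula for the sum of
    the roots.\<close>
  have "(\<mu>1 - \<mu>2) * (\<mu>1 + \<mu>2 - \<alpha> - \<beta>) = (\<mu>1 - \<alpha>) * (\<mu>1 - \<beta>) - (\<mu>2 - \<alpha>) * (\<mu>2 - \<beta>)"
    by (simp add: algebra_simps)
  then have "(\<mu>1 - \<mu>2) * (\<mu>1 + \<mu>2 - \<alpha> - \<beta>) = 0" using char by simp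
  then have "\<mu>1 + \<mu>2 - \<alpha> - \<beta> = 0" using ne by simp
  then have \<mu>2: "\<mu>2 = \<alpha> + \<beta> - \<mu>1" by algebra
  have cdh: "continuous_on {0..T} (\<lambda>t. d * h t)" by (intro continuous_intros h)
  obtain y1 where y1: "y1 0 = (\<beta> - \<mu>1) * u0 + d * v0"
    "\<And>t. t \<in> {0..T} \<Longrightarrow> (y1 has_vector_derivative (- \<mu>1 * y1 t + d * h t)) (at t within {0..T})"
    using linear_ode_solution_exists[OF cdh] by blast
  obtain y2 where y2: "y2 0 = (\<beta> - \<mu>2) * u0 + d * v0"
    "\<And>t. t \<in> {0..T} \<Longrightarrow> (y2 has_vector_derivative (- \<mu>2 * y2 t + d * h t)) (at t within {0..T})"
    using linear_ode_solution_exists[OF cdh] by blast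
  \<comment> \<open>The inverse of the change of coordinates, confirmed by \<open>Y1\<close> and
    \<open>Y2\<close>.\<close>
  define U where "U t = (1 / (\<mu>2 - \<mu>1)) * (y1 t - y2 t)" for t
  define V where "V t = (1 / d) * (y1 t - (\<beta> - \<mu>1) * U t)" for t
  have Y1: "y1 t = (\<beta> - \<mu>1) * U t + d * V t" for t using d by (simp add: V_def)
  have "(\<mu>2 - \<mu>1) * U t = y1 t - y2 t" for t using ne by (simp add: U_def)
  then have Y2: "y2 t = (\<beta> - \<mu>2) * U t + d * V t" for t using Y1[of t] by (simp add: algebra_simps)
  have dU: "(U has_vector_derivative (- \<alpha> * U t + d * V t)) (at t within {0..T})" if t: "t \<in> {0..T}" for t
  proof -
    have "(U has_vector_derivative (1 / (\<mu>2 - \<mu>1)) *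
        ((- \<mu>1 * y1 t + d * h t) - (- \<mu>2 * y2 t + d * h t))) (at t within {0..T})"
      unfolding U_def[abs_def]
      by (intro has_vector_derivative_mult_right has_vector_derivative_diff y1 y2 t)
    moreover have "(- \<mu>1 * y1 t + d * h t) - (- \<mu>2 * y2 t + d * h t) = (\<mu>2 - \<mu>1) * (- \<alpha> * U t + d * V t)"
      unfolding Y1 Y2 \<mu>2 by (simp add: algebra_simps)
    ultimately show ?thesis using ne by simp
  qed
  have dV: "(V has_vector_derivative (- \<beta> * V t + d * U t + h t)) (at t within {0..T})" if t: "t \<in> {0..T}" for t
  proof -
    have "(V has_vector_derivative (1 / d) *
        ((- \<mu>1 * y1 t + d * h t) - (\<beta> - \<mu>1) * (- \<alpha> * U t + d * V t))) (at t within {0..T})"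
      unfolding V_def[abs_def]
      by (intro has_vector_derivative_mult_right has_vector_derivative_diff y1 dU[unfolded V_def[abs_def]] t)
    moreover have "(- \<mu>1 * y1 t + d * h t) - (\<beta> - \<mu>1) * (- \<alpha> * U t + d * V t)
        = d * (- \<beta> * V t + d * U t + h t)"
    proof -
      have "d * (d * U t) = (\<mu>1 - \<alpha>) * (\<mu>1 - \<beta>) * U t" by (metis dd mult.assoc)
      then show ?thesis unfolding Y1 by (simp add: algebra_simps)
    qed
    ultimately show ?thesis using d by simp
  qed
  have U0: "U 0 = u0" using ne by (simp add: U_def y1(1) y2(1) field_simps)
  have V0: "V 0 = v0" using d by (simp add: V_def U0 y1(1))
  show thesis
  proof (rule that[of U V])
    show "continuous_on {0..T} U" "continuous_on {0..T} V"
      by (rule continuous_on_vector_derivative, erule dU) (rule continuous_on_vector_derivative, erule dV)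
    fix t assume t: "t \<in> {0..T}"
    show "((\<lambda>s. - \<alpha> * U s + d * V s) has_integral (U t - u0)) {0..t}"
      unfolding U0[symmetric]
    proof (rule fundamental_theorem_of_calculus)
      show "0 \<le> t" using t by simp
      fix s assume "s \<in> {0..t}"
      then have "s \<in> {0..T}" using t by simp
      from has_vector_derivative_within_subset[OF dU[OF this], of "{0..t}"] t
      show "(U has_vector_derivative (- \<alpha> * U s + d * V s)) (at s within {0..t})"
        by auto
    qed
    show "((\<lambda>s. - \<beta> * V s + d * U s + h s) has_integral (V t - v0)) {0..t}"
      unfolding V0[symmetric]
    proof (rule fundamental_theorem_of_calculus)
      show "0 \<le> t" using t by simp
      fix s assume "s \<in> {0..t}"
      then have "s \<in> {0..T}" using t by simp
      from has_vector_derivative_within_subset[OF dV[OF this], of "{0..t}"] t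
      show "(V has_vector_derivative (- \<beta> * V s + d * U s + h s)) (at s within {0..t})"
        by auto
    qed
  qed
qed

text \<open>For \<open>exp\<close> on an interval \<open>{a..b}\<close> the coefficient is a
  difference of two numbers of the distinct moduli \<open>exp b\<close> and \<open>exp a\<close>,
  divided by \<open>2 * pi * (1 + \<i> * k)\<close>, so it never vanishes. A bare indicator function
  could have vanishing coefficients.\<close>

lemma control_profile_exists:
  assumes "open \<omega>" "\<omega> \<noteq> {}"
  obtains f c where "L2_on \<omega> f" "0 < c"
    "\<And>k. c / (1 + \<bar>real_of_int k\<bar>) \<le> norm (fourier_coeff_on \<omega> f k)"
proof -
  obtain x e where e: "0 < e" "cball x e \<subseteq> \<omega>"
    using assms by (metis ex_in_conv open_contains_cball)
  define a b where "a = x - e" and "b = x + e"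
  have ab: "a < b" "{a..b} \<subseteq> \<omega>" using e by (auto simp: a_def b_def cball_eq_atLeastAtMost)
  define f :: "real \<Rightarrow> complex" where "f t = indicator {a..b} t *\<^sub>R of_real (exp t)" for t
  have restr: "indicator \<omega> t *\<^sub>R (indicator {a..b} t *\<^sub>R w) = indicator {a..b} t *\<^sub>R w"
    for t and w :: "'b::real_vector" using ab(2) by (auto simp: indicator_def)
  have abs_int: "set_integrable lebesgue {a..b} g" if "continuous_on {a..b} g" for g :: "real \<Rightarrow> 'b::euclidean_space"
    using absolutely_integrable_continuous[of a b g] that by simp
  have L2: "L2_on \<omega> f"
    unfolding L2_on_def
  proof
    have "set_integrable lebesgue {a..b} (\<lambda>t. complex_of_real (exp t))"
      by (intro abs_int continuous_intros)
    then show "set_borel_measurable lebesgue \<omega> f"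
      unfolding set_borel_measurable_def set_integrable_def f_def restr by (rule borel_measurable_integrable)
    have "set_integrable lebesgue {a..b} (\<lambda>t. (exp t)\<^sup>2)" by (intro abs_int continuous_intros)
    moreover have "indicator \<omega> t *\<^sub>R (norm (f t))\<^sup>2 = indicator {a..b} t *\<^sub>R (exp t)\<^sup>2" for t
      using ab(2) by (auto simp: f_def indicator_def)
    ultimately show "set_integrable lebesgue \<omega> (\<lambda>t. (cmod (f t))\<^sup>2)"
      unfolding set_integrable_def by simp
  qed
  define c where "c = (exp b - exp a) / (2 * pi)"
  have c: "0 < c" using ab by (simp add: c_def)
  show thesis
  proof (rule that[OF L2 c])
    fix k
    define z where "z = 1 + \<i> * of_int k"
    have z0: "z \<noteq> 0" by (simp add: z_def complex_eq_iff)
    have "(LINT t:\<omega>|lebesgue. f t * exp (\<i> * of_int k * of_real t))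
        = (LINT t:{a..b}|lebesgue. exp (z * of_real t))"
      unfolding set_lebesgue_integral_def
    proof (rule Bochner_Integration.integral_cong[OF refl])
      fix t
      have "of_real (exp t) * exp (\<i> * of_int k * of_real t) = exp (z * of_real t)"
        by (simp add: z_def algebra_simps exp_add exp_of_real)
      then show "indicat_real \<omega> t *\<^sub>R (f t * exp (\<i> * of_int k * of_real t))
          = indicat_real {a..b} t *\<^sub>R exp (z * of_real t)"
        using ab(2) by (auto simp: f_def indicator_def)
    qed
    also have "\<dots> = integral {a..b} (\<lambda>t. exp (z * of_real t))"
      by (intro set_lebesgue_integral_eq_integral abs_int continuous_intros)
    also have "\<dots> = exp (z * of_real b) / z - exp (z * of_real a) / z"
    proof (rule integral_unique, rule fundamental_theorem_of_calculus)
      fix t assume "t \<in> {a..b}"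
      show "((\<lambda>t. exp (z * of_real t) / z) has_vector_derivative exp (z * of_real t)) (at t within {a..b})"
        using has_vector_derivative_divide[OF has_vector_derivative_exp_of_real[of z t "{a..b}"], of z] z0
        by simp
    qed (use ab in simp)
    finally have F: "fourier_coeff_on \<omega> f k = (exp (z * of_real b) - exp (z * of_real a)) / (z * of_real (2 * pi))"
      by (simp add: fourier_coeff_on_def diff_divide_distrib)
    have "exp b - exp a \<le> norm (exp (z * of_real b) - exp (z * of_real a))"
      using norm_triangle_ineq2[of "exp (z * of_real b)" "exp (z * of_real a)"]
      by (simp add: norm_exp_eq_Re z_def)
    moreover have "norm z \<le> 1 + \<bar>real_of_int k\<bar>"
      using norm_triangle_ineq[of 1 "\<i> * of_int k"] by (simp add: z_def norm_mult)
    ultimately have "(exp b - exp a) / ((1 + \<bar>real_of_int k\<bar>) * (2 * pi))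
        \<le> norm (exp (z * of_real b) - exp (z * of_real a)) / (norm z * (2 * pi))"
      using z0 ab by (intro frac_le mult_right_mono) auto
    then show "c / (1 + \<bar>real_of_int k\<bar>) \<le> norm (fourier_coeff_on \<omega> f k)"
      unfolding F c_def by (simp add: norm_divide norm_mult mult_ac)
  qed
qed

text \<open>Each term of the convergent series is at most its sum. Any polynomial bound would do, so
  the exponents 1 and 2 share one.\<close>

lemma Hper_dual_coeff_bound:
  assumes "Hper_dual s \<phi>" "s \<le> 2"
  obtains C where "0 \<le> C" "\<And>k. norm (\<phi> k) \<le> C * (1 + (real_of_int k)\<^sup>2)"
proof -
  let ?g = "\<lambda>k. (1 + (real_of_int k)\<^sup>2) powr (- s) * (cmod (\<phi> k))\<^sup>2"
  define S where "S = infsum ?g UNIV"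
  have S: "?g k \<le> S" for k
    using finite_sum_le_infsum[of ?g UNIV "{k}"] assms(1) by (simp add: Hper_dual_def S_def)
  have S0: "0 \<le> S" using order_trans[OF _ S[of 0]] by simp
  show thesis
  proof (rule that[of "sqrt S"])
    show "0 \<le> sqrt S" using S0 by simp
    fix k
    define w where "w = 1 + (real_of_int k)\<^sup>2"
    have w: "1 \<le> w" by (simp add: w_def)
    have "(cmod (\<phi> k))\<^sup>2 = w powr s * ?g k" using w by (simp add: w_def[symmetric] powr_minus)
    also have "\<dots> \<le> w powr s * S" using S by (intro mult_left_mono) auto
    also have "\<dots> \<le> w powr 2 * S" using w S0 assms(2) by (intro mult_right_mono powr_mono) auto
    also have "\<dots> = (sqrt S * w)\<^sup>2" using w S0 by (simp add: power_mult_distrib powr_numeral)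
    finally show "norm (\<phi> k) \<le> sqrt S * (1 + (real_of_int k)\<^sup>2)"
      using w S0 unfolding w_def[symmetric] by (intro power2_le_imp_le[of "cmod (\<phi> k)"]) auto
  qed
qed

lemma has_integral_reverse_Icc:
  fixes f :: "real \<Rightarrow> 'a::real_normed_vector"
  assumes "(f has_integral I) {0..T}"
  shows "((\<lambda>t. f (T - t)) has_integral I) {0..T}"
proof -
  have "((\<lambda>t. f (- t)) has_integral I) {-T..-0}"
    using assms by (subst has_integral_reflect_real)
  from has_integral_shift_real_ivl[OF this, of "-T"] show ?thesis by simp
qed

section \<open>Null controllability\<close>

lemma dx_symbols:
  "(dx k)^4 + (dx k)^3 + (dx k)^2 = sym_u k" "(dx k)^2 - dx k = - sym_v k" "(dx k)\<^sup>2 = - ((of_int k)\<^sup>2)"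
  by (simp_all add: dx_def sym_u_def sym_v_def complex_eq_iff power2_eq_square power3_eq_cube power4_eq_xxxx)

lemma int_encode_le: "real (int_encode k) \<le> 2 * \<bar>real_of_int k\<bar>"
  by (cases "0 \<le> k") (auto simp: int_encode_def sum_encode_def)

text \<open>Each mode receives two consecutive indices, and parity selects the eigenvalue. This
  lists all eigenvalues as one sequence in which the modulus of the mode grows linearly with the
  index.\<close>

definition mode_index :: "nat \<Rightarrow> int" where
  "mode_index j = int_decode (j div 2)"

lemma mode_index_surj:
  obtains j where "mode_index j = k" "even j = s"
proof (cases s)
  case True
  then show thesis using that[of "2 * int_encode k"] by (simp add: mode_index_def)
next
  case False
  then show thesis using that[of "2 * int_encode k + 1"] by (simp add: mode_index_def)
qed

lemma mode_index_inj:
  assumes "mode_index i = mode_index j" "even i = even j"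
  shows "i = j"
proof -
  have "i div 2 = j div 2" using assms(1) unfolding mode_index_def by (metis int_decode_inverse)
  then show ?thesis using assms(2) by (metis bit_eq_rec)
qed

lemma mode_index_growth: "real j \<le> 4 * \<bar>real_of_int (mode_index j)\<bar> + 1"
proof -
  have "real (j div 2) \<le> 2 * \<bar>real_of_int (mode_index j)\<bar>"
    using int_encode_le[of "mode_index j"] by (simp add: mode_index_def)
  moreover have "real j \<le> 2 * real (j div 2) + 1" by linarith
  ultimately show ?thesis by linarith
qed

text \<open>The fourth power of \<open>x \<le> exp x\<close> at \<open>x = a * (1 + w)\<close>. It
  lets the dissipation absorb polynomial growth.\<close>

lemma power4_le_exp:
  fixes w a :: real
  assumes "0 < a" "0 \<le> w"
  shows "(1 + w) ^ 4 \<le> exp (4 * a) / a ^ 4 * exp (4 * a * w)"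
proof -
  have "a * (1 + w) \<le> exp (a * (1 + w))" using exp_ge_add_one_self[of "a * (1 + w)"] by linarith
  then have "(a * (1 + w)) ^ 4 \<le> exp (a * (1 + w)) ^ 4" using assms by (intro power_mono) auto
  also have "\<dots> = exp (4 * (a * (1 + w)))" using exp_of_nat_mult[of 4 "a * (1 + w)"] by simp
  also have "\<dots> = exp (4 * a) * exp (4 * a * w)" by (simp add: algebra_simps flip: exp_add)
  finally have "a ^ 4 * (1 + w) ^ 4 \<le> exp (4 * a) * exp (4 * a * w)" unfolding power_mult_distrib .
  then show ?thesis using assms by (simp add: pos_le_divide_eq mult_ac)
qed

theorem theorem1p2:
  fixes T :: real and \<omega> :: "real set" and u0 v0 :: "int \<Rightarrow> complex"
  assumes "T > 0"
    and "open \<omega>" and "\<omega> \<noteq> {}" and "\<omega> \<subseteq> {0<..<2 * pi}"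
    and "Hper_dual 2 u0" and "Hper_dual 1 v0"
    and "dual_pairing u0 one_fc = 0"
  shows "\<exists>f g :: real \<Rightarrow> complex.
           L2_on \<omega> f \<and> L2_on {0<..<T} g \<and>
           (let hk = (\<lambda>k t. fourier_coeff_on \<omega> f k * g t) in
             (\<exists>U V. is_solution T u0 v0 hk U V) \<and>
             (\<forall>U V. is_solution T u0 v0 hk U V \<longrightarrow>
                (\<forall>k. U k T = 0 \<and> V k T = 0)))"
proof -
  obtain M :: "int \<Rightarrow> bool \<Rightarrow> complex" where
    M_char: "\<And>k s. k \<noteq> 0 \<Longrightarrow> (M k s - sym_u k) * (M k s - sym_v k) = - ((of_int k)\<^sup>2)"
    and M0: "M 0 True = 0" "M 0 False = 2"
    and M_Re: "\<And>k s. (real_of_int k)\<^sup>2 / 8 \<le> Re (M k s)"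
    and M_up: "\<And>k s. norm (M k s) \<le> 4 * (1 + (real_of_int k)\<^sup>2)\<^sup>2"
    and M_gap: "\<And>k s m r. (k, s) \<noteq> (m, r) \<Longrightarrow> 1/8 \<le> norm (M k s - M m r)"
    by (rule eigenvalues_exist) (rule that)
  have char: "(M k s - sym_u k) * (M k s - sym_v k) = (dx k)\<^sup>2" if "k \<noteq> 0" for k s
    using M_char[OF that] by (simp add: dx_symbols)
  obtain f c0 where f: "L2_on \<omega> f" and c0: "0 < c0"
    and f_low: "\<And>k. c0 / (1 + \<bar>real_of_int k\<bar>) \<le> norm (fourier_coeff_on \<omega> f k)"
    using control_profile_exists[OF assms(2,3)] by blast
  define b where "b k = fourier_coeff_on \<omega> f k" for k
  have b0: "b k \<noteq> 0" for k
  proof -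
    have "0 < c0 / (1 + \<bar>real_of_int k\<bar>)" using c0 by (intro divide_pos_pos) auto
    then show ?thesis using f_low[of k] by (auto simp: b_def)
  qed
  obtain Cu where Cu: "0 \<le> Cu" "\<And>k. norm (u0 k) \<le> Cu * (1 + (real_of_int k)\<^sup>2)"
    using Hper_dual_coeff_bound[OF assms(5)] by auto
  obtain Cv where Cv: "0 \<le> Cv" "\<And>k. norm (v0 k) \<le> Cv * (1 + (real_of_int k)\<^sup>2)"
    using Hper_dual_coeff_bound[OF assms(6)] by auto
  \<comment> \<open>The mean of \<open>u\<close> is invariant under the system and out of reach of
    the control, so it has to vanish from the start.\<close>
  have u00: "u0 0 = 0"
  proof -
    have "infsum (\<lambda>k. u0 k * cnj (one_fc k)) UNIV = infsum (\<lambda>k. u0 k * cnj (one_fc k)) {0}"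
      by (rule infsum_cong_neutral) (auto simp: one_fc_def)
    then show ?thesis using assms(7) by (simp add: dual_pairing_def one_fc_def)
  qed
  \<comment> \<open>Initial value of the decoupled left eigenvector component.\<close>
  define y0 where "y0 k s = (sym_v k - M k s) * u0 k + dx k * v0 k" for k s
  \<comment> \<open>Duhamel's formula for that component, set to 0 at time \<open>T\<close> and
    written for the time-reversed control. In mode 0 only \<open>v\<close> is steered, through the
    eigenvalue 0; the dummy eigenvalue gets the moment 0.\<close>
  define c where "c k s = (if k = 0 then (if s then - v0 0 / b 0 else 0)
     else - exp (- M k s * of_real T) * (y0 k s / (dx k * b k)))" for k s
  \<comment> \<open>With \<open>w = 1 + k\<^sup>2\<close>, the 7 bounds
    \<open>sym_v k - M k s\<close> by \<open>7 * w\<^sup>2\<close>, and \<open>2 / c0\<close> comes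
    from the lower bound \<open>c0 / (2 * w)\<close> for the modulus of
    \<open>dx k * b k\<close>.\<close>
  define C where "C = (7 * Cu + Cv) * (2 / c0)"
  \<comment> \<open>\<open>4 * (T / 64) = T / 2 * (1/8)\<close>, so with \<open>M_Re\<close> the
    polynomial factor costs half of the decay \<open>exp (- T * Re (M k s))\<close>.\<close>
  define K where "K = exp (4 * (T / 64)) / (T / 64) ^ 4"
  have C: "0 \<le> C" using Cu(1) Cv(1) c0 by (simp add: C_def)
  have y_bound: "norm (y0 k s / (dx k * b k)) \<le> C * (1 + (real_of_int k)\<^sup>2) ^ 4" if k: "k \<noteq> 0" for k s
  proof -
    define w where "w = 1 + (real_of_int k)\<^sup>2"
    have w1: "1 \<le> w" by (simp add: w_def)
    have kw: "\<bar>real_of_int k\<bar> \<le> w"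
    proof -
      have "0 \<le> (\<bar>real_of_int k\<bar> - 1)\<^sup>2" by simp
      then have "2 * \<bar>real_of_int k\<bar> \<le> w" by (simp add: power2_diff w_def)
      then show ?thesis by linarith
    qed
    have ww: "w \<le> w\<^sup>2" using w1 by (simp add: power2_eq_square)
    have k1: "1 \<le> \<bar>real_of_int k\<bar>" using k by linarith
    have "norm (sym_v k) \<le> \<bar>Re (sym_v k)\<bar> + \<bar>Im (sym_v k)\<bar>" by (rule cmod_le)
    also have "\<dots> \<le> 2 * w" using kw by (simp add: sym_v_def w_def)
    also have "\<dots> \<le> 3 * w\<^sup>2" using ww w1 by simp
    finally have "norm (sym_v k - M k s) \<le> 7 * w\<^sup>2"
      using norm_triangle_ineq4[of "sym_v k" "M k s"] M_up[of k s] by (simp add: w_def)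
    then have "norm ((sym_v k - M k s) * u0 k) \<le> (7 * w\<^sup>2) * (Cu * w)"
      unfolding norm_mult using Cu w1 by (intro mult_mono) (auto simp: w_def)
    moreover have "norm (dx k * v0 k) \<le> w * (Cv * w)"
      unfolding norm_mult using Cv kw w1 by (intro mult_mono) (auto simp: w_def dx_def norm_mult)
    moreover have "w * (Cv * w) \<le> w\<^sup>2 * (Cv * w)" using ww Cv(1) w1 by (intro mult_right_mono) auto
    ultimately have y: "norm (y0 k s) \<le> (7 * Cu + Cv) * w ^ 3"
      using norm_triangle_ineq[of "(sym_v k - M k s) * u0 k" "dx k * v0 k"]
      by (simp add: y0_def algebra_simps power2_eq_square power3_eq_cube)
    have "c0 / (2 * w) \<le> c0 / (1 + \<bar>real_of_int k\<bar>)"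
      using kw w1 c0 by (intro divide_left_mono) auto
    then have "1 * (c0 / (2 * w)) \<le> norm (dx k) * norm (b k)"
      using f_low[of k] k1 c0 w1 by (intro mult_mono) (auto simp: b_def dx_def norm_mult)
    then have db: "c0 / (2 * w) \<le> norm (dx k * b k)" by (simp add: norm_mult)
    have "norm (y0 k s / (dx k * b k)) \<le> ((7 * Cu + Cv) * w ^ 3) / (c0 / (2 * w))"
      unfolding norm_divide using y db c0 w1 Cu Cv by (intro frac_le) auto
    also have "\<dots> = C * w ^ 4" by (simp add: C_def power3_eq_cube power4_eq_xxxx)
    finally show ?thesis by (simp add: w_def)
  qed
  \<comment> \<open>The second summand takes care of mode 0.\<close>
  define B where "B = C * K + norm (v0 0 / b 0)"
  have K: "0 \<le> K" using assms(1) by (simp add: K_def)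
  have c_bound: "norm (c k s) \<le> B * exp (- (T / 2) * Re (M k s))" for k s
  proof (cases "k = 0")
    case True
    have "0 \<le> B" using C K by (simp add: B_def)
    then show ?thesis using True C K M0 by (cases s) (simp_all add: c_def B_def norm_divide)
  next
    case False
    have "(1 + (real_of_int k)\<^sup>2) ^ 4 \<le> K * exp (4 * (T / 64) * (real_of_int k)\<^sup>2)"
      unfolding K_def using assms(1) by (intro power4_le_exp) auto
    also have "\<dots> \<le> K * exp (T / 2 * Re (M k s))"
    proof (intro mult_left_mono K)
      have "T / 2 * ((real_of_int k)\<^sup>2 / 8) \<le> T / 2 * Re (M k s)"
        using assms(1) by (intro mult_left_mono M_Re) auto
      then show "exp (4 * (T / 64) * (real_of_int k)\<^sup>2) \<le> exp (T / 2 * Re (M k s))" by simp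
    qed
    finally have "C * (1 + (real_of_int k)\<^sup>2) ^ 4 \<le> C * (K * exp (T / 2 * Re (M k s)))"
      using C by (intro mult_left_mono)
    then have "norm (y0 k s / (dx k * b k)) \<le> C * (K * exp (T / 2 * Re (M k s)))"
      using y_bound[OF False, of s] by linarith
    also have "\<dots> \<le> B * exp (T / 2 * Re (M k s))" unfolding B_def by (simp add: algebra_simps)
    finally have y: "norm (y0 k s / (dx k * b k)) \<le> B * exp (T / 2 * Re (M k s))" .
    have "norm (c k s) = exp (- Re (M k s) * T) * norm (y0 k s / (dx k * b k))"
      using False by (simp add: c_def norm_mult norm_divide norm_exp_eq_Re)
    also have "\<dots> \<le> exp (- Re (M k s) * T) * (B * exp (T / 2 * Re (M k s)))"
      by (intro mult_left_mono y) simp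
    also have "\<dots> = B * exp (- (T / 2) * Re (M k s))"
      by (simp add: mult_ac flip: exp_add)
    finally show ?thesis .
  qed
  define \<mu> where "\<mu> j = M (mode_index j) (even j)" for j
  \<comment> \<open>For a nonzero mode \<open>j\<close> is at most 5 times its modulus, and 200 = 25
    * 8. Mode 0 owns the indices 0 and 1, with eigenvalues 0 and 2.\<close>
  have growth: "1/200 * (real j)\<^sup>2 \<le> Re (\<mu> j)" for j
  proof (cases "mode_index j = 0")
    case True
    then have "j = 0 \<or> j = 1" using mode_index_growth[of j] by auto
    moreover have "mode_index 0 = 0" "mode_index 1 = 0"
      by (simp_all add: mode_index_def int_decode_def sum_decode_def)
    ultimately show ?thesis using M0 by (auto simp: \<mu>_def)
  next
    case False
    then have "1 \<le> \<bar>real_of_int (mode_index j)\<bar>" by linarith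
    then have "real j \<le> 5 * \<bar>real_of_int (mode_index j)\<bar>" using mode_index_growth[of j] by linarith
    then have "(real j)\<^sup>2 \<le> (5 * \<bar>real_of_int (mode_index j)\<bar>)\<^sup>2" by (intro power_mono) auto
    then show ?thesis using M_Re[of "mode_index j" "even j"] by (simp add: \<mu>_def power_mult_distrib)
  qed
  have gap: "1/8 \<le> norm (\<mu> i - \<mu> j)" if "i \<noteq> j" for i j
    unfolding \<mu>_def by (rule M_gap) (use mode_index_inj that in auto)
  obtain G where G: "continuous_on UNIV G"
    and GI: "\<And>j. ((\<lambda>t. exp (- \<mu> j * of_real t) * G t) has_integral c (mode_index j) (even j)) {0..T}"
  proof (rule exponential_moment_problem[of "1/200" "1/8" T "T / 2" \<mu> "\<lambda>j. c (mode_index j) (even j)" B])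
    show "norm (c (mode_index j) (even j)) \<le> B * exp (- (T / 2) * Re (\<mu> j))" for j
      unfolding \<mu>_def by (rule c_bound)
  qed (use assms(1) growth gap in auto)
  \<comment> \<open>Time reversal turns moments against \<open>exp (- \<mu> j * t)\<close> into the
    growing exponentials of Duhamel's formula.\<close>
  define g where "g t = G (T - t)" for t
  have g: "continuous_on S g" for S
    unfolding g_def by (rule continuous_on_compose2[OF G]) (auto intro: continuous_intros)
  have gI: "((\<lambda>t. exp (M k s * of_real t) * g t) has_integral exp (M k s * of_real T) * c k s) {0..T}" for k s
  proof -
    obtain j where j: "mode_index j = k" "even j = s" by (rule mode_index_surj)
    have "((\<lambda>t. exp (M k s * of_real T) * (exp (- M k s * of_real (T - t)) * G (T - t))) has_integral
        exp (M k s * of_real T) * c k s) {0..T}"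
      using has_integral_mult_right[OF has_integral_reverse_Icc[OF GI[of j]]] j by (simp add: \<mu>_def)
    moreover have "exp (M k s * of_real T) * (exp (- M k s * of_real (T - t)) * G (T - t)) = exp (M k s * of_real t) * g t" for t
      by (simp add: g_def algebra_simps flip: exp_add)
    ultimately show ?thesis by (simp only:)
  qed
  define hk where "hk = (\<lambda>k t. b k * g t)"
  have hk: "continuous_on S (hk k)" for S k unfolding hk_def by (intro continuous_intros g)
  have L2g: "L2_on {0<..<T} g"
    unfolding L2_on_def
  proof
    have "continuous_on {0..T} (\<lambda>x. (cmod (g x))\<^sup>2)" by (intro continuous_intros g)
    then have "set_integrable lebesgue {0..T} (\<lambda>x. (cmod (g x))\<^sup>2)"
      using absolutely_integrable_continuous[of 0 T "\<lambda>x. (cmod (g x))\<^sup>2"] by simp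
    then show "set_integrable lebesgue {0<..<T} (\<lambda>x. (cmod (g x))\<^sup>2)"
      by (rule set_integrable_subset) auto
    have "set_integrable lebesgue {0..T} g"
      using absolutely_integrable_continuous[of 0 T g] g by auto
    then have "set_integrable lebesgue {0<..<T} g"
      by (rule set_integrable_subset) auto
    then show "set_borel_measurable lebesgue {0<..<T} g"
      unfolding set_integrable_def set_borel_measurable_def by (rule borel_measurable_integrable)
  qed
  \<comment> \<open>The control is prescribed, so the modes do not interact and solutions can be
    chosen mode by mode.\<close>
  define mode_sol where "mode_sol k U V \<longleftrightarrow> continuous_on {0..T} U \<and> continuous_on {0..T} V \<and>
        (\<forall>t\<in>{0..T}.
          ((\<lambda>s. - sym_u k * U s + dx k * V s) has_integral (U t - u0 k)) {0..t} \<and>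
          ((\<lambda>s. - sym_v k * V s + dx k * U s + hk k s) has_integral (V t - v0 k)) {0..t})" for k U V
  have sol_iff: "is_solution T u0 v0 hk U V \<longleftrightarrow> (\<forall>k. mode_sol k (U k) (V k))" for U V
    unfolding is_solution_def dx_symbols(1,2) mode_sol_def ..
  have sym0: "sym_u 0 = 0" "sym_v 0 = 0" "dx 0 = 0"
    by (simp_all add: sym_u_def sym_v_def dx_def complex_eq_iff)
  have ex: "\<exists>U V. is_solution T u0 v0 hk U V"
  proof -
    have "\<exists>U V. mode_sol k U V" for k
    proof (cases "k = 0")
      case True
      \<comment> \<open>The coupling \<open>dx 0\<close> vanishes, so mode 0 is integrated
        directly.\<close>
      have int: "hk 0 integrable_on {0..t}" for t by (intro integrable_continuous_interval hk)
      have "continuous_on {0..T} (\<lambda>t. v0 0 + integral {0..t} (hk 0))"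
        by (intro continuous_intros indefinite_integral_continuous_1 int)
      then show ?thesis using True int
        by (intro exI[of _ "\<lambda>_. u0 0"] exI[of _ "\<lambda>t. v0 0 + integral {0..t} (hk 0)"])
          (auto simp: mode_sol_def sym0 has_integral_integral[symmetric])
    next
      case False
      have d0: "dx k \<noteq> 0" using False by (simp add: dx_def)
      have "M k True \<noteq> M k False" using M_gap[of k True k False] by auto
      then show ?thesis
        by (rule linear_system_solution_exists[OF hk d0 _ char[OF False] char[OF False]])
          (use mode_sol_def in blast)
    qed
    then have "\<exists>U V. \<forall>k. mode_sol k (U k) (V k)" by metis
    then show ?thesis unfolding sol_iff by blast
  qed
  have null: "U k T = 0 \<and> V k T = 0" if "is_solution T u0 v0 hk U V" for U V k
  proof -
    have T0: "0 \<le> T" and TT: "T \<in> {0..T}" using assms(1) by auto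
    have cU: "continuous_on {0..T} (U k)" and cV: "continuous_on {0..T} (V k)"
      and eU: "\<And>t. t \<in> {0..T} \<Longrightarrow> ((\<lambda>s. - sym_u k * U k s + dx k * V k s) has_integral (U k t - u0 k)) {0..t}"
      and eV: "\<And>t. t \<in> {0..T} \<Longrightarrow> ((\<lambda>s. - sym_v k * V k s + dx k * U k s + hk k s) has_integral (V k t - v0 k)) {0..t}"
      using that unfolding sol_iff mode_sol_def by blast+
    show ?thesis
    proof (cases "k = 0")
      case True
      have "((\<lambda>s. 0) has_integral (U 0 T - u0 0)) {0..T}" using eU[OF TT] True by (simp add: sym0)
      then have "U 0 T = 0" using has_integral_unique[OF _ has_integral_0] u00 by fastforce
      have "((\<lambda>s. b 0 * g s) has_integral (V 0 T - v0 0)) {0..T}" using eV[OF TT] True by (simp add: sym0 hk_def)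
      moreover have "((\<lambda>s. b 0 * g s) has_integral b 0 * (- v0 0 / b 0)) {0..T}"
        using has_integral_mult_right[OF gI[of 0 True], of "b 0"] by (simp add: M0 c_def)
      ultimately have "V 0 T - v0 0 = b 0 * (- v0 0 / b 0)" by (rule has_integral_unique)
      then show ?thesis using True \<open>U 0 T = 0\<close> b0[of 0] by simp
    next
      case False
      have d0: "dx k \<noteq> 0" using False by (simp add: dx_def)
      \<comment> \<open>The choice of \<open>c k s\<close> cancels each left eigenvector component
        at time \<open>T\<close>; as the two eigenvalues differ, both unknowns vanish.\<close>
      have z: "(sym_v k - M k s) * U k T + dx k * V k T = 0" for s
      proof -
        have "((\<lambda>t. exp (M k s * of_real t) * hk k t) has_integral
            b k * (exp (M k s * of_real T) * c k s)) {0..T}"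
          using has_integral_mult_right[OF gI[of k s], of "b k"] by (simp add: hk_def mult_ac)
        from linear_system_terminal_value[OF T0 cU cV hk char[OF False] eU eV this]
        have "(sym_v k - M k s) * U k T + dx k * V k T = exp (- M k s * of_real T) *
            (y0 k s + dx k * (b k * (exp (M k s * of_real T) * c k s)))"
          by (simp add: y0_def)
        moreover have "exp (M k s * of_real T) * c k s = - (y0 k s / (dx k * b k))"
          using False by (simp add: c_def exp_minus)
        then have "dx k * (b k * (exp (M k s * of_real T) * c k s)) = - y0 k s"
          using d0 b0[of k] by simp
        ultimately show ?thesis by simp
      qed
      have "M k True \<noteq> M k False" using M_gap[of k True k False] by auto
      moreover have "(M k True - M k False) * U k T = 0"
        using z[of True] z[of False] by (simp add: algebra_simps)
      ultimately have "U k T = 0" by simp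
      then show ?thesis using z[of True] d0 by simp
    qed
  qed
  show ?thesis
    using f L2g ex null unfolding hk_def b_def Let_def by blast
qed

end
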